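(* Let $\eta\in\{\mathbf{i},\mathbf{j},\mathbf{k}\}$, let $\mathcal{A}=\mathcal{A}^{\eta*}\in\mathbb{H}^{I_{1}\times \cdots \times I_{N}\times I_{1}\times \cdots \times I_{N}}$ and let $r=\operatorname{rank}(f(\mathcal{A}))$. Then there exists a unitary quaternion tensor $\mathcal{U}\in\mathbb{H}^{I_{1}\times \cdots \times I_{N}\times I_{1}\times \cdots \times I_{N}}$ such that $$\mathcal{A}=\mathcal{U}*_{N}\mathcal{B}*_{N}\mathcal{U}^{\eta*},$$ where $\mathcal{B}\in\mathbb{R}^{I_{1}\times \cdots \times I_{N}\times I_{1}\times \cdots \times I_{N}}$ has the structure $$\mathcal{B}_{i_{1}\cdots i_{N}j_{1}\cdots j_{N}}=\begin{cases} d_{i}, & \text{if } (i_{1},\ldots,i_{N},j_{1},\ldots,j_{N})=(p_{1}^{i},\ldots,p_{N}^{i},p_{1}^{i},\ldots,p_{N}^{i}) \text{ for some } i\in\{1,\ldots,r\},\\ 0, & \text{otherwise,}\end{cases}$$ $d_{1},\ldots,d_{r}$ are the nonzero singular values of the quaternion matrix $f(\mathcal{A})$, and the indices are determined recursively, for $i=1,\ldots,r$, by $$p_{t}^{i}=\left[\frac{i-1-\sum_{k=t+1}^{N}(p_{k}^{i}-1)\prod_{s=1}^{k-1}I_{s}}{\prod_{s=1}^{t-1}I_{s}}\right]+1\quad (t=N,N-1,\ldots,2),\qquad p_{1}^{i}=i-\sum_{k=2}^{N}(p_{k}^{i}-1)\prod_{s=1}^{k-1}I_{s},$$ where $[a]$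 denotes the largest integer less than or equal to the real number $a$ (for $t=N$ the sum in the numerator is empty).
   Context: $\mathbb{H}$ is the real quaternion algebra $\{q_0+q_1\mathbf{i}+q_2\mathbf{j}+q_3\mathbf{k}: q_0,\ldots,q_3\in\mathbb{R}\}$ with $\mathbf{i}^2=\mathbf{j}^2=\mathbf{k}^2=\mathbf{ijk}=-1$, and $\bar q=q_0-q_1\mathbf{i}-q_2\mathbf{j}-q_3\mathbf{k}$. $\mathbb{H}^{I_1\times\cdots\times I_N}$ (resp. $\mathbb{R}^{I_1\times\cdots\times I_N}$) is the set of order $N$ arrays $(a_{i_1\cdots i_N})_{1\le i_j\le I_j}$ with quaternion (resp. real) entries. Einstein product: for $\mathcal{A}\in\mathbb{H}^{I_{1}\times \cdots \times I_{N}\times J_{1}\times \cdots \times J_{N}}$ and $\mathcal{B}\in\mathbb{H}^{J_{1}\times \cdots \times J_{N}\times K_{1}\times \cdots \times K_{M}}$, $\mathcal{A}*_N\mathcal{B}\in\mathbb{H}^{I_{1}\times \cdots \times I_{N}\times K_{1}\times \cdots \times K_{M}}$ is given by $(\mathcal{A}*_{N}\mathcal{B})_{i_{1}\cdots i_{N}k_{1}\cdots k_{M}}=\sum_{j_{1}\cdots j_{N}}a_{i_{1}\cdots i_{N}j_{1}\cdots j_{N}}b_{j_{1}\cdots j_{N}k_{1}\cdots k_{M}}$. Conjugate transpose: $(\mathcal{A}^* )_{j_1\cdots j_Ni_1\cdots i_N}=\overline{a_{i_1\cdots i_Nj_1\cdots j_N}}$. For $\eta\in\{\mathbf{i},\mathbf{j},\mathbf{k}\}$,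 $\mathcal{A}^{\eta*}=-\eta\mathcal{A}^*\eta$ (entrywise multiplication by $\eta$ on both sides); a square tensor with $\mathcal{A}=\mathcal{A}^{\eta*}$ is called $\eta$-Hermitian. The unit tensor $\mathcal{I}$ has entry $1$ at positions $(i_1,\ldots,i_N,i_1,\ldots,i_N)$ and $0$ elsewhere. $\mathcal{U}\in\mathbb{H}^{I_{1}\times \cdots \times I_{N}\times I_{1}\times \cdots \times I_{N}}$ is unitary if $\mathcal{U}*_N\mathcal{U}^*=\mathcal{U}^**_N\mathcal{U}=\mathcal{I}$. Transformation $f$: for $\mathcal{A}\in\mathbb{H}^{I_{1}\times \cdots \times I_{N}\times J_{1}\times \cdots \times J_{N}}$, $f(\mathcal{A})$ is the quaternion matrix of size $(I_1\cdots I_N)\times(J_1\cdots J_N)$ whose entry in row $i_{1}+\sum_{k=2}^{N}(i_{k}-1)\prod_{s=1}^{k-1}I_{s}$ and column $j_{1}+\sum_{k=2}^{N}(j_{k}-1)\prod_{s=1}^{k-1}J_{s}$ is $a_{i_1\cdots i_Nj_1\cdots j_N}$. The nonzero (positive) singular values of a quaternion matrix $A$ of rank $r$ are the positive reals $d_1,\ldots,d_r$ (with multiplicity) in a decomposition $A=U\begin{pmatrix}D_r&0\\0&0\end{pmatrix}V^*$ with $U,V$ unitary quaternion matrices and $D_r=\mathrm{diag}(d_1,\ldots,d_r)$. *)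

theory Defs
  imports Complex_Main "HOL-Library.FuncSet" "Jordan_Normal_Form.Matrix"
begin

section \<open>Quaternions\<close>

datatype quat = Quat (q_re: real) (q_i: real) (q_j: real) (q_k: real)

lemma quat_eq_iff:
  "p = q \<longleftrightarrow> q_re p = q_re q \<and> q_i p = q_i q \<and> q_j p = q_j q \<and> q_k p = q_k q"
  by (cases p; cases q) auto

instantiation quat :: ring_1
begin

definition "0 = Quat 0 0 0 0"
definition "1 = Quat 1 0 0 0"
definition "p + q = Quat (q_re p + q_re q) (q_i p + q_i q) (q_j p + q_j q) (q_k p + q_k q)"
definition "p - q = Quat (q_re p - q_re q) (q_i p - q_i q) (q_j p - q_j q) (q_k p - q_k q)"
definition "- q = Quat (- q_re q) (- q_i q) (- q_j q) (- q_k q)"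
definition "p * q = Quat
  (q_re p * q_re q - q_i p * q_i q - q_j p * q_j q - q_k p * q_k q)
  (q_re p * q_i q + q_i p * q_re q + q_j p * q_k q - q_k p * q_j q)
  (q_re p * q_j q - q_i p * q_k q + q_j p * q_re q + q_k p * q_i q)
  (q_re p * q_k q + q_i p * q_j q - q_j p * q_i q + q_k p * q_re q)"

lemmas quat_ring_defs =
  zero_quat_def one_quat_def plus_quat_def minus_quat_def uminus_quat_def times_quat_def

instance
  by standard (simp_all add: quat_ring_defs algebra_simps)

end

instantiation quat :: real_algebra_1
begin

definition "c *\<^sub>R q = Quat (c * q_re q) (c * q_i q) (c * q_j q) (c * q_k q)"

instance
  by standard (simp_all add: quat_ring_defs scaleR_quat_def algebra_simps)

end

definition quat_i :: quat where "quat_i = Quat 0 1 0 0"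
definition quat_j :: quat where "quat_j = Quat 0 0 1 0"
definition quat_k :: quat where "quat_k = Quat 0 0 0 1"

lemma quat_units:
  "quat_i * quat_i = -1" "quat_j * quat_j = -1" "quat_k * quat_k = -1"
  "quat_i * quat_j * quat_k = -1"
  by (simp_all add: quat_i_def quat_j_def quat_k_def quat_ring_defs)

lemma quat_basis:
  "Quat a b c d = of_real a + of_real b * quat_i + of_real c * quat_j + of_real d * quat_k"
  by (simp add: quat_i_def quat_j_def quat_k_def quat_ring_defs of_real_def scaleR_quat_def)

definition quat_cnj :: "quat \<Rightarrow> quat" where
  "quat_cnj q = Quat (q_re q) (- q_i q) (- q_j q) (- q_k q)"

section \<open>Quaternion matrices\<close>

text \<open>The adjoint of the library is restricted to fields, hence unavailable for quaternions.\<close>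

definition quat_adjoint :: "quat mat \<Rightarrow> quat mat" where
  "quat_adjoint A = mat (dim_col A) (dim_row A) (\<lambda>(i, j). quat_cnj (A $$ (j, i)))"

definition unitary_quat_mat :: "nat \<Rightarrow> quat mat \<Rightarrow> bool" where
  "unitary_quat_mat n U \<longleftrightarrow> U \<in> carrier_mat n n \<and>
     U * quat_adjoint U = 1\<^sub>m n \<and> quat_adjoint U * U = 1\<^sub>m n"

text \<open>
  The rank of a quaternion matrix is the maximal number of right linearly independent columns:
  the scalars of a linear combination of columns multiply from the right.
\<close>

definition right_indep_cols :: "quat mat \<Rightarrow> nat set \<Rightarrow> bool" where
  "right_indep_cols A S \<longleftrightarrow>
     (\<forall>c :: nat \<Rightarrow> quat.
        (\<forall>i<dim_row A. (\<Sum>j\<in>S. A $$ (i, j) * c j) = 0) \<longrightarrow> (\<forall>j\<in>S. c j = 0))"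

definition quat_rank :: "quat mat \<Rightarrow> nat" where
  "quat_rank A = Max (card ` {S. S \<subseteq> {..<dim_col A} \<and> right_indep_cols A S})"

text \<open>The \<open>m \<times> n\<close> matrix with upper left block \<open>diag (d 1, \<dots>, d r)\<close> and zeros elsewhere.\<close>

definition diag_block_mat :: "nat \<Rightarrow> nat \<Rightarrow> nat \<Rightarrow> (nat \<Rightarrow> real) \<Rightarrow> quat mat" where
  "diag_block_mat m n r d =
     mat m n (\<lambda>(i, j). if i = j \<and> i < r then of_real (d (i + 1)) else 0)"

text \<open>
  \<open>d 1, \<dots>, d r\<close> are the nonzero singular values of \<open>A\<close>, listed with multiplicity in some order;
  the values of \<open>d\<close> at other arguments are irrelevant.
\<close>

definition nonzero_singular_values :: "quat mat \<Rightarrow> nat \<Rightarrow> (nat \<Rightarrow> real) \<Rightarrow> bool" where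
  "nonzero_singular_values A r d \<longleftrightarrow>
     r = quat_rank A \<and> (\<forall>i\<in>{1..r}. 0 < d i) \<and>
     (\<exists>U V. unitary_quat_mat (dim_row A) U \<and> unitary_quat_mat (dim_col A) V \<and>
        A = U * diag_block_mat (dim_row A) (dim_col A) r d * quat_adjoint V)"

section \<open>Tensors\<close>

text \<open>
  A multi-index \<open>(i\<^sub>1, \<dots>, i\<^sub>N)\<close> is a function on \<open>{1..N}\<close> (extensional, i.e. \<open>undefined\<close> elsewhere),
  and the dimensions \<open>I\<^sub>1, \<dots>, I\<^sub>N\<close> are the values \<open>I 1, \<dots>, I N\<close>.  An array of size
  \<open>I\<^sub>1 \<times> \<dots> \<times> I\<^sub>N \<times> J\<^sub>1 \<times> \<dots> \<times> J\<^sub>M\<close> takes its two groups of indices as two arguments and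
  is \<open>0\<close> outside the index range, so that equality of tensors is equality of functions.
\<close>

type_synonym multi_index = "nat \<Rightarrow> nat"
type_synonym 'a tensor = "multi_index \<Rightarrow> multi_index \<Rightarrow> 'a"

definition multi_indices :: "nat \<Rightarrow> (nat \<Rightarrow> nat) \<Rightarrow> multi_index set" where
  "multi_indices N I = (\<Pi>\<^sub>E k\<in>{1..N}. {1..I k})"

definition tensors :: "nat \<Rightarrow> (nat \<Rightarrow> nat) \<Rightarrow> nat \<Rightarrow> (nat \<Rightarrow> nat) \<Rightarrow> 'a::zero tensor set" where
  "tensors N I M J =
     {A. \<forall>i j. A i j \<noteq> 0 \<longrightarrow> i \<in> multi_indices N I \<and> j \<in> multi_indices M J}"

text \<open>\<open>N\<close> and \<open>J\<close> describe the group of indices that is contracted.\<close>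

definition einstein_prod ::
  "nat \<Rightarrow> (nat \<Rightarrow> nat) \<Rightarrow> 'a::semiring_0 tensor \<Rightarrow> 'a tensor \<Rightarrow> 'a tensor" where
  "einstein_prod N J A B = (\<lambda>i k. \<Sum>j\<in>multi_indices N J. A i j * B j k)"

definition conj_transpose :: "quat tensor \<Rightarrow> quat tensor" where
  "conj_transpose A = (\<lambda>j i. quat_cnj (A i j))"

definition eta_adjoint :: "quat \<Rightarrow> quat tensor \<Rightarrow> quat tensor" where
  "eta_adjoint \<eta> A = (\<lambda>j i. - (\<eta> * conj_transpose A j i * \<eta>))"

definition unit_tensor :: "nat \<Rightarrow> (nat \<Rightarrow> nat) \<Rightarrow> quat tensor" where
  "unit_tensor N I = (\<lambda>i j. if i = j \<and> i \<in> multi_indices N I then 1 else 0)"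

definition unitary_tensor :: "nat \<Rightarrow> (nat \<Rightarrow> nat) \<Rightarrow> quat tensor \<Rightarrow> bool" where
  "unitary_tensor N I U \<longleftrightarrow> U \<in> tensors N I N I \<and>
     einstein_prod N I U (conj_transpose U) = unit_tensor N I \<and>
     einstein_prod N I (conj_transpose U) U = unit_tensor N I"

definition of_real_tensor :: "real tensor \<Rightarrow> quat tensor" where
  "of_real_tensor B = (\<lambda>i j. of_real (B i j))"

section \<open>The transformation \<open>f\<close>\<close>

text \<open>The (1-based) row or column number assigned to a multi-index.\<close>

definition lin_index :: "nat \<Rightarrow> (nat \<Rightarrow> nat) \<Rightarrow> multi_index \<Rightarrow> nat" where
  "lin_index N I i = i 1 + (\<Sum>k=2..N. (i k - 1) * (\<Prod>s=1..k-1. I s))"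

text \<open>Matrix indices of the library are 0-based, hence the shift by one.\<close>

definition flatten :: "nat \<Rightarrow> (nat \<Rightarrow> nat) \<Rightarrow> (nat \<Rightarrow> nat) \<Rightarrow> quat tensor \<Rightarrow> quat mat" where
  "flatten N I J A = mat (\<Prod>k=1..N. I k) (\<Prod>k=1..N. J k)
     (\<lambda>(a, b). A (the_inv_into (multi_indices N I) (lin_index N I) (a + 1))
                 (the_inv_into (multi_indices N J) (lin_index N J) (b + 1)))"

section \<open>The positions \<open>p\<^sup>m = (p\<^sub>1\<^sup>m, \<dots>, p\<^sub>N\<^sup>m)\<close>\<close>

text \<open>\<open>pos_entry N I m t\<close> is \<open>p\<^sub>t\<^sup>m\<close>, meant for \<open>1 \<le> t \<le> N\<close>; the recursion runs downwards from
  \<open>t = N\<close>.  It is carried out in the integers to avoid truncated subtraction.\<close>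

function pos_entry :: "nat \<Rightarrow> (nat \<Rightarrow> nat) \<Rightarrow> nat \<Rightarrow> nat \<Rightarrow> int" where
  "pos_entry N I m t =
     (if t = 1 then
        int m - (\<Sum>k=2..N. (pos_entry N I m k - 1) * (\<Prod>s=1..k-1. int (I s)))
      else
        \<lfloor>real_of_int (int m - 1 - (\<Sum>k=t+1..N. (pos_entry N I m k - 1) * (\<Prod>s=1..k-1. int (I s))))
           / real_of_int (\<Prod>s=1..t-1. int (I s))\<rfloor> + 1)"
  by auto
termination
  by (relation "measure (\<lambda>(N, I, m, t). N + 1 - t)") auto

declare pos_entry.simps [simp del]

definition pos_index :: "nat \<Rightarrow> (nat \<Rightarrow> nat) \<Rightarrow> nat \<Rightarrow> multi_index" where
  "pos_index N I m = (\<lambda>t\<in>{1..N}. nat (pos_entry N I m t))"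

text \<open>\<open>lin_index\<close> is a bijection, so \<open>flatten\<close> does what it should, and \<open>pos_index\<close> is its inverse.\<close>

lemma lin_index_eq:
  assumes "1 \<le> N" "i \<in> multi_indices N I"
  shows "int (lin_index N I i) = 1 + (\<Sum>k=1..N. (int (i k) - 1) * (\<Prod>s=1..k-1. int (I s)))"
proof -
  have ge: "i k \<ge> 1" if "k \<in> {1..N}" for k
    using assms(2) that by (auto simp: multi_indices_def PiE_def Pi_def)
  have "int (\<Sum>k=2..N. (i k - 1) * (\<Prod>s=1..k-1. I s))
      = (\<Sum>k=2..N. (int (i k) - 1) * (\<Prod>s=1..k-1. int (I s)))"
    unfolding of_nat_sum by (rule sum.cong) (use ge in \<open>auto simp: of_nat_diff\<close>)
  moreover have "{1..N} = insert 1 {2..N}" using assms(1) by auto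
  ultimately show ?thesis by (simp add: lin_index_def)
qed

lemma digit_sum_bounds:
  fixes i I :: "nat \<Rightarrow> nat" and t :: nat
  assumes "\<And>k. k \<in> {1..t} \<Longrightarrow> 1 \<le> i k \<and> i k \<le> I k"
  shows "0 \<le> (\<Sum>k=1..t. (int (i k) - 1) * (\<Prod>s=1..k-1. int (I s)))
       \<and> (\<Sum>k=1..t. (int (i k) - 1) * (\<Prod>s=1..k-1. int (I s))) < (\<Prod>s=1..t. int (I s))"
  using assms
proof (induction t)
  case 0
  then show ?case by simp
next
  case (Suc t)
  let ?P = "\<Prod>s=1..t. int (I s)" and ?S = "\<Sum>k=1..t. (int (i k) - 1) * (\<Prod>s=1..k-1. int (I s))"
  have b: "0 \<le> ?S" "?S < ?P" using Suc by auto
  have k: "1 \<le> i (Suc t)" "i (Suc t) \<le> I (Suc t)" using Suc.prems by auto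
  have "(int (i (Suc t)) - 1) * ?P \<le> (int (I (Suc t)) - 1) * ?P"
    using b k by (intro mult_right_mono) auto
  then have "(int (i (Suc t)) - 1) * ?P \<le> ?P * int (I (Suc t)) - ?P"
    by (simp add: algebra_simps)
  moreover have "0 \<le> (int (i (Suc t)) - 1) * ?P" using b k by auto
  moreover have "(\<Sum>k=1..Suc t. (int (i k) - 1) * (\<Prod>s=1..k-1. int (I s)))
      = ?S + (int (i (Suc t)) - 1) * ?P"
    and "(\<Prod>s=1..Suc t. int (I s)) = ?P * int (I (Suc t))"
    by simp_all
  ultimately show ?case using b by linarith
qed

lemma lin_index_range:
  assumes "1 \<le> N" "i \<in> multi_indices N I"
  shows "lin_index N I i \<in> {1..\<Prod>k=1..N. I k}"
proof -
  have "1 \<le> i k \<and> i k \<le> I k" if "k \<in> {1..N}" for k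
    using assms(2) that by (auto simp: multi_indices_def PiE_def Pi_def)
  then have "1 \<le> int (lin_index N I i)" "int (lin_index N I i) \<le> int (\<Prod>k=1..N. I k)"
    using lin_index_eq[OF assms] digit_sum_bounds[of N i I] by simp_all
  then show ?thesis unfolding of_nat_le_iff by simp
qed

lemma pos_index_lin_index:
  assumes "1 \<le> N" and i: "i \<in> multi_indices N I"
  shows "pos_index N I (lin_index N I i) = i"
proof -
  let ?m = "lin_index N I i"
  let ?P = "\<lambda>t. \<Prod>s=1..t-1. int (I s)"
  have bnd: "1 \<le> i k \<and> i k \<le> I k" if "k \<in> {1..N}" for k
    using i that by (auto simp: multi_indices_def PiE_def Pi_def)
  have m: "int ?m = 1 + (\<Sum>k=1..N. (int (i k) - 1) * ?P k)"
    by (rule lin_index_eq) fact+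
  have pe: "pos_entry N I ?m t = int (i t)" if "t \<in> {1..N}" for t
    using that
  proof (induction t rule: measure_induct_rule[where f = "\<lambda>t. N - t"])
    case (less t)
    have IH: "pos_entry N I ?m k = int (i k)" if "k \<in> {t+1..N}" for k
      using less.IH[of k] less.prems that by auto
    have eq: "(\<Sum>k=t+1..N. (pos_entry N I ?m k - 1) * ?P k) = (\<Sum>k=t+1..N. (int (i k) - 1) * ?P k)"
      by (rule sum.cong) (auto simp: IH)
    have "(\<Sum>k=1..N. (int (i k) - 1) * ?P k)
        = (\<Sum>k=1..t. (int (i k) - 1) * ?P k) + (\<Sum>k=t+1..N. (int (i k) - 1) * ?P k)"
      using less.prems by (subst sum.union_disjoint[symmetric]) (auto intro!: sum.cong)
    moreover have "{1..t} = insert t {1..t-1}" using less.prems by auto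
    then have "(\<Sum>k=1..t. (int (i k) - 1) * ?P k)
        = (int (i t) - 1) * ?P t + (\<Sum>k=1..t-1. (int (i k) - 1) * ?P k)"
      using less.prems by (simp only:) (subst sum.insert, auto)
    ultimately have split: "int ?m - 1 - (\<Sum>k=t+1..N. (pos_entry N I ?m k - 1) * ?P k)
        = (\<Sum>k=1..t-1. (int (i k) - 1) * ?P k) + (int (i t) - 1) * ?P t"
      unfolding m eq by linarith
    show ?case
    proof (cases "t = 1")
      case True
      then show ?thesis using split
        by (subst pos_entry.simps) (simp add: numeral_2_eq_2)
    next
      case False
      have b: "0 \<le> (\<Sum>k=1..t-1. (int (i k) - 1) * ?P k)" "(\<Sum>k=1..t-1. (int (i k) - 1) * ?P k) < ?P t"
      proof -
        have "1 \<le> i k \<and> i k \<le> I k" if "k \<in> {1..t-1}" for k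
          using bnd[of k] less.prems that by auto
        from digit_sum_bounds[of "t-1" i I, OF this] show
          "0 \<le> (\<Sum>k=1..t-1. (int (i k) - 1) * ?P k)" "(\<Sum>k=1..t-1. (int (i k) - 1) * ?P k) < ?P t"
          by blast+
      qed
      then have "((\<Sum>k=1..t-1. (int (i k) - 1) * ?P k) + (int (i t) - 1) * ?P t) div ?P t
          = int (i t) - 1"
      proof -
        have "(x + c * q) div q = c" if "0 \<le> x" "x < q" for x c q :: int
          using that by (simp add: div_pos_pos_trivial)
        from this[OF b] show ?thesis .
      qed
      then show ?thesis
        by (subst pos_entry.simps, subst if_not_P[OF False])
          (simp only: split floor_divide_of_int_eq diff_add_cancel)
    qed
  qed
  show ?thesis
  proof
    fix t show "pos_index N I ?m t = i t"
      using i pe[of t] by (auto simp: pos_index_def multi_indices_def PiE_def extensional_def)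
  qed
qed

lemma bij_betw_lin_index:
  assumes "1 \<le> N"
  shows "bij_betw (lin_index N I) (multi_indices N I) {1..\<Prod>k=1..N. I k}"
proof -
  have inj: "inj_on (lin_index N I) (multi_indices N I)"
    by (rule inj_on_inverseI) (rule pos_index_lin_index[OF assms])
  have "card (multi_indices N I) = (\<Prod>k=1..N. I k)"
    by (simp add: multi_indices_def card_PiE)
  then have "lin_index N I ` multi_indices N I = {1..\<Prod>k=1..N. I k}"
    using lin_index_range[OF assms] card_image[OF inj] by (intro card_subset_eq) auto
  with inj show ?thesis by (simp add: bij_betw_def)
qed

lemma flatten_entry:
  assumes "1 \<le> N" "i \<in> multi_indices N I" "j \<in> multi_indices N J"
  shows "flatten N I J A $$ (lin_index N I i - 1, lin_index N J j - 1) = A i j"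
proof -
  have "the_inv_into (multi_indices N K) (lin_index N K) (lin_index N K k) = k"
    and "lin_index N K k - 1 < (\<Prod>k=1..N. K k)" and "lin_index N K k - 1 + 1 = lin_index N K k"
    if "k \<in> multi_indices N K" for k K
    using bij_betw_lin_index[OF assms(1), of K] lin_index_range[OF assms(1) that] that
    by (auto simp: bij_betw_def intro!: the_inv_into_f_f)
  from this[OF assms(2)] this[OF assms(3)] show ?thesis
    by (simp only: flatten_def index_mat prod.case)
qed

lemma pos_index_in:
  assumes "1 \<le> N" "m \<in> {1..\<Prod>k=1..N. I k}"
  shows "pos_index N I m \<in> multi_indices N I" "lin_index N I (pos_index N I m) = m"
proof -
  obtain i where "i \<in> multi_indices N I" "m = lin_index N I i"
    using bij_betw_imp_surj_on[OF bij_betw_lin_index[OF assms(1), of I]] assms(2) by blast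
  then show "pos_index N I m \<in> multi_indices N I" "lin_index N I (pos_index N I m) = m"
    using pos_index_lin_index[OF assms(1)] by auto
qed

end

theory Submission
  imports Defs "HOL-Computational_Algebra.Fundamental_Theorem_Algebra"
begin

text \<open>
  Since \<open>\<eta>\<^sup>2 = -1\<close>, \<open>A\<close> is \<open>\<eta>\<close>-Hermitian iff \<open>A \<eta>\<close> is skew-Hermitian, and
  \<open>A = U B U\<^sup>\<eta>\<^sup>*\<close> amounts to \<open>A \<eta> = U (B \<eta>) U\<^sup>*\<close>.  A skew-Hermitian quaternion matrix has an
  orthonormal basis of right eigenvectors: as long as the orthogonal complement of the eigenvectors
  already found contains some \<open>x \<noteq> 0\<close>, a complex polynomial of least degree annihilating \<open>x\<close> has a
  root, which yields an eigenvector in that invariant complement.  Its eigenvalue is purely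
  imaginary, hence conjugate in the quaternions to \<open>d \<eta>\<close> with \<open>d \<ge> 0\<close>, and rescaling the
  eigenvector on the right makes the eigenvalue \<open>d \<eta>\<close>.
  With \<open>V = (U\<^sup>\<eta>\<^sup>*)\<^sup>*\<close>, the result \<open>A = U B V\<^sup>*\<close> is a singular value decomposition.
\<close>

section \<open>The division ring of quaternions\<close>

lemma quat_components [simp]:
  "q_re 0 = 0" "q_i 0 = 0" "q_j 0 = 0" "q_k 0 = 0"
  "q_re 1 = 1" "q_i 1 = 0" "q_j 1 = 0" "q_k 1 = 0"
  "q_re (p + q) = q_re p + q_re q" "q_i (p + q) = q_i p + q_i q"
  "q_j (p + q) = q_j p + q_j q" "q_k (p + q) = q_k p + q_k q"
  "q_re (p - q) = q_re p - q_re q" "q_i (p - q) = q_i p - q_i q"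
  "q_j (p - q) = q_j p - q_j q" "q_k (p - q) = q_k p - q_k q"
  "q_re (- q) = - q_re q" "q_i (- q) = - q_i q" "q_j (- q) = - q_j q" "q_k (- q) = - q_k q"
  "q_re (c *\<^sub>R q) = c * q_re q" "q_i (c *\<^sub>R q) = c * q_i q"
  "q_j (c *\<^sub>R q) = c * q_j q" "q_k (c *\<^sub>R q) = c * q_k q"
  "q_re (p * q) = q_re p * q_re q - q_i p * q_i q - q_j p * q_j q - q_k p * q_k q"
  "q_i (p * q) = q_re p * q_i q + q_i p * q_re q + q_j p * q_k q - q_k p * q_j q"
  "q_j (p * q) = q_re p * q_j q - q_i p * q_k q + q_j p * q_re q + q_k p * q_i q"
  "q_k (p * q) = q_re p * q_k q + q_i p * q_j q - q_j p * q_i q + q_k p * q_re q"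
  "q_re (quat_cnj q) = q_re q" "q_i (quat_cnj q) = - q_i q"
  "q_j (quat_cnj q) = - q_j q" "q_k (quat_cnj q) = - q_k q"
  by (simp_all add: quat_ring_defs scaleR_quat_def quat_cnj_def)

lemma quat_components_sum:
  "q_re (sum f S) = (\<Sum>x\<in>S. q_re (f x))" "q_i (sum f S) = (\<Sum>x\<in>S. q_i (f x))"
  "q_j (sum f S) = (\<Sum>x\<in>S. q_j (f x))" "q_k (sum f S) = (\<Sum>x\<in>S. q_k (f x))"
  by (induction S rule: infinite_finite_induct) simp_all

definition quat_sqnorm :: "quat \<Rightarrow> real" where
  "quat_sqnorm q = (q_re q)\<^sup>2 + (q_i q)\<^sup>2 + (q_j q)\<^sup>2 + (q_k q)\<^sup>2"

lemma quat_sqnorm_nonneg: "0 \<le> quat_sqnorm q"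
  by (simp add: quat_sqnorm_def)

lemma quat_sqnorm_eq_0_iff: "quat_sqnorm q = 0 \<longleftrightarrow> q = 0"
  by (simp add: quat_sqnorm_def quat_eq_iff add_nonneg_eq_0_iff)

lemma quat_cnj_mult_self: "quat_cnj q * q = quat_sqnorm q *\<^sub>R 1"
  and quat_mult_cnj_self: "q * quat_cnj q = quat_sqnorm q *\<^sub>R 1"
  by (simp_all add: quat_eq_iff quat_sqnorm_def power2_eq_square)

instantiation quat :: real_div_algebra
begin

definition "inverse q = (1 / quat_sqnorm q) *\<^sub>R quat_cnj q"
definition "p div q = p * inverse q" for p q :: quat

instance
proof
  fix p q :: quat
  show "q \<noteq> 0 \<Longrightarrow> inverse q * q = 1" "q \<noteq> 0 \<Longrightarrow> q * inverse q = 1"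
    by (simp_all add: inverse_quat_def quat_cnj_mult_self quat_mult_cnj_self quat_sqnorm_eq_0_iff)
  show "p div q = p * inverse q" "inverse (0 :: quat) = 0"
    by (simp_all add: divide_quat_def inverse_quat_def quat_eq_iff)
qed

end

lemma quat_cnj_simps [simp]:
  "quat_cnj 0 = 0" "quat_cnj 1 = 1" "quat_cnj (- q) = - quat_cnj q"
  "quat_cnj (quat_cnj q) = q" "quat_cnj (p + q) = quat_cnj p + quat_cnj q"
  "quat_cnj (c *\<^sub>R q) = c *\<^sub>R quat_cnj q"
  by (simp_all add: quat_eq_iff)

lemma quat_cnj_mult: "quat_cnj (p * q) = quat_cnj q * quat_cnj p"
  by (simp add: quat_eq_iff algebra_simps)

lemma quat_cnj_sum: "quat_cnj (sum f S) = (\<Sum>x\<in>S. quat_cnj (f x))"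
  by (simp add: quat_eq_iff quat_components_sum sum_negf)

text \<open>Conjugation by the anticommuting \<open>q\<close> of the last claim turns \<eta> into
  -\<eta>; \<open>pure_quat_similar_eta\<close> uses this to flip a sign.\<close>

lemma eta_props:
  assumes "\<eta> \<in> {quat_i, quat_j, quat_k}"
  shows "\<eta> * \<eta> = -1" "quat_cnj \<eta> = - \<eta>" "\<exists>q. q \<noteq> 0 \<and> \<eta> * q = - (q * \<eta>)"
proof -
  show "\<eta> * \<eta> = -1" "quat_cnj \<eta> = - \<eta>"
    using assms by (auto simp: quat_i_def quat_j_def quat_k_def quat_eq_iff)
  have "\<eta> * q = - (q * \<eta>)"
    if "(\<eta>, q) \<in> {(quat_i, quat_j), (quat_j, quat_k), (quat_k, quat_i)}" for q
    using that by (auto simp: quat_i_def quat_j_def quat_k_def quat_eq_iff)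
  moreover have "quat_i \<noteq> 0" "quat_j \<noteq> 0" "quat_k \<noteq> 0"
    by (auto simp: quat_i_def quat_j_def quat_k_def quat_eq_iff)
  ultimately show "\<exists>q. q \<noteq> 0 \<and> \<eta> * q = - (q * \<eta>)"
    using assms by blast
qed

text \<open>With d = |c|, purity gives c^2 = -d^2 = (d \<eta>)^2. Two elements with equal squares
  are intertwined by their sum, so q = c + d \<eta> works whenever it is nonzero.\<close>

lemma pure_quat_similar_eta:
  assumes eta: "\<eta> \<in> {quat_i, quat_j, quat_k}" and pure: "quat_cnj c = - c"
  obtains q d where "q \<noteq> 0" "0 \<le> d" "c * q = q * (d *\<^sub>R \<eta>)"
proof -
  define d where "d = sqrt (quat_sqnorm c)"
  have d: "0 \<le> d" "d * d = quat_sqnorm c"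
    by (simp_all add: d_def quat_sqnorm_nonneg)
  have cc: "c * c = - ((d * d) *\<^sub>R 1)"
    unfolding d(2) quat_cnj_mult_self[of c, symmetric] pure by simp
  show thesis
  proof (cases "c + d *\<^sub>R \<eta> = 0")
    \<comment> \<open>Here c = -d \<eta>, which includes c = 0; a quaternion anticommuting with
      \<eta> replaces the vanishing sum.\<close>
    case True
    then have c: "c = - (d *\<^sub>R \<eta>)" by (simp add: eq_neg_iff_add_eq_0)
    obtain q where "q \<noteq> 0" "\<eta> * q = - (q * \<eta>)" using eta_props[OF eta] by blast
    then show thesis using that[of q d] d c by simp
  next
    case False
    have "c * (c + d *\<^sub>R \<eta>) = (c + d *\<^sub>R \<eta>) * (d *\<^sub>R \<eta>)"
      by (simp add: distrib_left distrib_right scaleR_diff_right cc eta_props(1)[OF eta])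
    then show thesis using that False d by blast
  qed
qed

section \<open>Linear systems over a division ring\<close>

lemma homogeneous_system_solution:
  fixes a :: "'e \<Rightarrow> 'u \<Rightarrow> 'q::division_ring"
  assumes "finite E" "finite T" "card E < card T"
  shows "\<exists>x. (\<exists>t\<in>T. x t \<noteq> 0) \<and> (\<forall>e\<in>E. (\<Sum>t\<in>T. a e t * x t) = 0)"
  using assms
proof (induction E arbitrary: T a rule: finite_induct)
  case empty
  then show ?case by (intro exI[of _ "\<lambda>_. 1"]) (auto simp: card_gt_0_iff)
next
  case (insert e E)
  show ?case
  proof (cases "\<forall>t\<in>T. a e t = 0")
    case True
    then show ?thesis using insert.IH[of T a] insert.prems insert.hyps by auto
  next
    case False
    then obtain t0 where t0: "t0 \<in> T" "a e t0 \<noteq> 0" by auto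
    let ?T = "T - {t0}"
    \<comment> \<open>The pivot \<open>a e t0\<close> removes the unknown \<open>t0\<close> from
      equation \<open>f\<close>.\<close>
    define b where "b f t = a f t - a f t0 * inverse (a e t0) * a e t" for f t
    have "card E < card ?T" using insert.prems insert.hyps t0 by simp
    then obtain x where x: "\<exists>t\<in>?T. x t \<noteq> 0" "\<And>f. f \<in> E \<Longrightarrow> (\<Sum>t\<in>?T. b f t * x t) = 0"
      using insert.IH[of ?T b] insert.prems by auto
    define w where "w = (\<Sum>t\<in>?T. a e t * x t)"
    \<comment> \<open>Equation \<open>e\<close>, solved for the unknown \<open>t0\<close>, forces
      this value.\<close>
    define y where "y = x(t0 := - (inverse (a e t0) * w))"
    have sum_y: "(\<Sum>t\<in>T. a f t * y t) = (\<Sum>t\<in>?T. a f t * x t) - a f t0 * inverse (a e t0) * w" for f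
    proof -
      have "(\<Sum>t\<in>T. a f t * y t) = a f t0 * y t0 + (\<Sum>t\<in>?T. a f t * y t)"
        using insert.prems t0 by (simp add: sum.remove)
      also have "(\<Sum>t\<in>?T. a f t * y t) = (\<Sum>t\<in>?T. a f t * x t)"
        by (rule sum.cong) (auto simp: y_def)
      finally show ?thesis by (simp add: y_def mult.assoc)
    qed
    have "(\<Sum>t\<in>T. a e t * y t) = 0"
      using t0 by (simp add: sum_y w_def)
    moreover have "(\<Sum>t\<in>T. a f t * y t) = 0" if "f \<in> E" for f
    proof -
      have "(\<Sum>t\<in>T. a f t * y t) = (\<Sum>t\<in>?T. b f t * x t)"
        unfolding sum_y w_def b_def sum_distrib_left left_diff_distrib sum_subtractf
        by (simp add: mult.assoc)
      then show ?thesis using x(2)[OF that] by simp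
    qed
    moreover have "\<exists>t\<in>T. y t \<noteq> 0" using x(1) by (auto simp: y_def)
    ultimately show ?thesis by (intro exI[of _ y]) auto
  qed
qed

text \<open>The notion behind \<open>right_indep_cols\<close>, freed from matrices so that it
  applies to any division ring and to the columns of different matrices alike.\<close>

definition right_indep :: "'r set \<Rightarrow> 't set \<Rightarrow> ('r \<Rightarrow> 't \<Rightarrow> 'q::ring) \<Rightarrow> bool" where
  "right_indep R T b \<longleftrightarrow>
     (\<forall>c. (\<forall>i\<in>R. (\<Sum>t\<in>T. b i t * c t) = 0) \<longrightarrow> (\<forall>t\<in>T. c t = 0))"

text \<open>The Steinitz bound: if T had more elements than S, the coefficients \<open>g\<close>
  would admit a nontrivial relation, and the same relation would hold for the vectors
  \<open>b\<close>.\<close>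

lemma right_indep_card_le:
  fixes b :: "'r \<Rightarrow> 't \<Rightarrow> 'q::division_ring"
  assumes "finite S" "finite T" and ind: "right_indep R T b"
    and span: "\<And>i t. i \<in> R \<Longrightarrow> t \<in> T \<Longrightarrow> b i t = (\<Sum>s\<in>S. a i s * g s t)"
  shows "card T \<le> card S"
proof (rule ccontr)
  assume "\<not> card T \<le> card S"
  then obtain x where x: "\<exists>t\<in>T. x t \<noteq> 0" "\<And>s. s \<in> S \<Longrightarrow> (\<Sum>t\<in>T. g s t * x t) = 0"
    using homogeneous_system_solution[of S T g] assms by auto
  have "(\<Sum>t\<in>T. b i t * x t) = 0" if "i \<in> R" for i
  proof -
    have "(\<Sum>t\<in>T. b i t * x t) = (\<Sum>t\<in>T. \<Sum>s\<in>S. a i s * (g s t * x t))"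
      using that by (intro sum.cong) (auto simp: span sum_distrib_right mult.assoc)
    also have "\<dots> = (\<Sum>s\<in>S. a i s * (\<Sum>t\<in>T. g s t * x t))"
      unfolding sum_distrib_left by (rule sum.swap)
    finally show ?thesis using x(2) by simp
  qed
  then show False using ind x(1) unfolding right_indep_def by blast
qed

text \<open>In a nontrivial relation the coefficient of \<open>j\<close> is nonzero, because S alone
  is independent; dividing by it on the right expresses column \<open>j\<close>.\<close>

lemma right_indep_insert:
  fixes b :: "'r \<Rightarrow> 't \<Rightarrow> 'q::division_ring"
  assumes "finite S" "j \<notin> S" "right_indep R S b" "\<not> right_indep R (insert j S) b"
  shows "\<exists>g. \<forall>i\<in>R. b i j = (\<Sum>s\<in>S. b i s * g s)"
proof -
  obtain c where c: "\<And>i. i \<in> R \<Longrightarrow> b i j * c j + (\<Sum>t\<in>S. b i t * c t) = 0"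
    and nz: "\<exists>t\<in>insert j S. c t \<noteq> 0"
    using assms by (auto simp: right_indep_def)
  have cj: "c j \<noteq> 0"
  proof
    assume "c j = 0"
    then show False using c nz assms(3) by (auto simp: right_indep_def)
  qed
  have "b i j = (\<Sum>s\<in>S. b i s * - (c s * inverse (c j)))" if "i \<in> R" for i
  proof -
    have "b i j = (b i j * c j) * inverse (c j)"
      using cj by (simp add: mult.assoc)
    also have "b i j * c j = - (\<Sum>t\<in>S. b i t * c t)"
      using c[OF that] by (simp add: eq_neg_iff_add_eq_0)
    finally show ?thesis by (simp add: sum_distrib_right sum_negf mult.assoc)
  qed
  then show ?thesis by (intro exI[of _ "\<lambda>s. - (c s * inverse (c j))"]) auto
qed

section \<open>Quaternion vectors indexed by a finite set\<close>

text \<open>Conjugating the first argument makes the form right linear in the second, which matches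
  scalars acting on vectors from the right.\<close>

definition qinner :: "'a set \<Rightarrow> ('a \<Rightarrow> quat) \<Rightarrow> ('a \<Rightarrow> quat) \<Rightarrow> quat" where
  "qinner S x y = (\<Sum>i\<in>S. quat_cnj (x i) * y i)"

definition qapply :: "'a set \<Rightarrow> ('a \<Rightarrow> 'a \<Rightarrow> quat) \<Rightarrow> ('a \<Rightarrow> quat) \<Rightarrow> 'a \<Rightarrow> quat" where
  "qapply S D x = (\<lambda>i. \<Sum>j\<in>S. D i j * x j)"

lemma qinner_cong:
  "(\<And>i. i \<in> S \<Longrightarrow> x i = x' i) \<Longrightarrow> (\<And>i. i \<in> S \<Longrightarrow> y i = y' i) \<Longrightarrow> qinner S x y = qinner S x' y'"
  by (simp add: qinner_def)

lemma qinner_cnj: "quat_cnj (qinner S x y) = qinner S y x"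
  by (simp add: qinner_def quat_cnj_sum quat_cnj_mult)

lemma qinner_add_right: "qinner S x (\<lambda>i. y i + z i) = qinner S x y + qinner S x z"
  by (simp add: qinner_def distrib_left sum.distrib)

lemma qinner_mult_right: "qinner S x (\<lambda>i. y i * c) = qinner S x y * c"
  by (simp add: qinner_def sum_distrib_right mult.assoc)

lemma qinner_mult_left: "qinner S (\<lambda>i. x i * c) y = quat_cnj c * qinner S x y"
  by (simp add: qinner_def sum_distrib_left quat_cnj_mult mult.assoc)

lemma qinner_sum_right: "qinner S x (\<lambda>i. \<Sum>t\<in>T. y t i) = (\<Sum>t\<in>T. qinner S x (y t))"
  unfolding qinner_def sum_distrib_left by (rule sum.swap)

lemma qinner_self: "qinner S x x = (\<Sum>i\<in>S. quat_sqnorm (x i)) *\<^sub>R 1"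
  by (simp add: qinner_def quat_cnj_mult_self scaleR_left.sum)

lemma qinner_self_pos:
  assumes "finite S" "\<exists>i\<in>S. x i \<noteq> 0"
  shows "0 < (\<Sum>i\<in>S. quat_sqnorm (x i))"
proof -
  have "0 \<le> (\<Sum>i\<in>S. quat_sqnorm (x i))" by (simp add: sum_nonneg quat_sqnorm_nonneg)
  moreover have "(\<Sum>i\<in>S. quat_sqnorm (x i)) \<noteq> 0"
    using assms by (simp add: sum_nonneg_eq_0_iff quat_sqnorm_nonneg quat_sqnorm_eq_0_iff)
  ultimately show ?thesis by simp
qed

lemma qapply_mult_right: "qapply S D (\<lambda>j. x j * c) i = qapply S D x i * c"
  by (simp add: qapply_def sum_distrib_right mult.assoc)

lemma qapply_add: "qapply S D (\<lambda>j. x j + y j) i = qapply S D x i + qapply S D y i"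
  by (simp add: qapply_def distrib_left sum.distrib)

lemma qapply_zero [simp]: "qapply S D (\<lambda>j. 0) = (\<lambda>i. 0)"
  by (simp add: qapply_def)

definition skew_hermitian_on :: "'a set \<Rightarrow> ('a \<Rightarrow> 'a \<Rightarrow> quat) \<Rightarrow> bool" where
  "skew_hermitian_on S D \<longleftrightarrow> (\<forall>i\<in>S. \<forall>j\<in>S. D j i = - quat_cnj (D i j))"

lemma qinner_qapply_skew:
  assumes "skew_hermitian_on S D"
  shows "qinner S x (qapply S D y) = - qinner S (qapply S D x) y"
proof -
  have "qinner S x (qapply S D y) = (\<Sum>i\<in>S. \<Sum>j\<in>S. quat_cnj (x i) * D i j * y j)"
    by (simp add: qinner_def qapply_def sum_distrib_left mult.assoc)
  also have "\<dots> = (\<Sum>j\<in>S. \<Sum>i\<in>S. quat_cnj (x i) * D i j * y j)"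
    by (rule sum.swap)
  also have "\<dots> = (\<Sum>j\<in>S. \<Sum>i\<in>S. - (quat_cnj (D j i * x i) * y j))"
  proof (intro sum.cong refl)
    fix i j assume "i \<in> S" "j \<in> S"
    then have "D i j = - quat_cnj (D j i)" using assms unfolding skew_hermitian_on_def by blast
    then show "quat_cnj (x i) * D i j * y j = - (quat_cnj (D j i * x i) * y j)"
      by (simp add: quat_cnj_mult)
  qed
  also have "\<dots> = - qinner S (qapply S D x) y"
    by (simp add: qinner_def qapply_def quat_cnj_sum sum_distrib_right sum_negf)
  finally show ?thesis .
qed

section \<open>Right eigenvectors\<close>

text \<open>Right multiplication by \<open>\<real> + \<real> \<i>\<close> makes quaternion vectors a complex vector space on which
  a quaternion matrix acts linearly, so complex polynomials in that matrix make sense.\<close>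

definition quat_of_complex :: "complex \<Rightarrow> quat" where
  "quat_of_complex z = Quat (Re z) (Im z) 0 0"

lemma quat_of_complex_components [simp]:
  "q_re (quat_of_complex z) = Re z" "q_i (quat_of_complex z) = Im z"
  "q_j (quat_of_complex z) = 0" "q_k (quat_of_complex z) = 0"
  by (simp_all add: quat_of_complex_def)

lemma quat_of_complex_simps [simp]:
  "quat_of_complex 0 = 0"
  "quat_of_complex (z + w) = quat_of_complex z + quat_of_complex w"
  "quat_of_complex (- z) = - quat_of_complex z"
  "quat_of_complex (z * w) = quat_of_complex z * quat_of_complex w"
  "quat_of_complex (of_real c) = c *\<^sub>R 1"
  "quat_of_complex z = 0 \<longleftrightarrow> z = 0"
  by (auto simp: quat_eq_iff complex_eq_iff)

text \<open>Horner's rule for p(D) x, the sum of the vectors D^k x a_k, where the coefficients a_k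
  act from the right.\<close>

definition poly_apply ::
  "'a set \<Rightarrow> ('a \<Rightarrow> 'a \<Rightarrow> quat) \<Rightarrow> ('a \<Rightarrow> quat) \<Rightarrow> complex poly \<Rightarrow> 'a \<Rightarrow> quat" where
  "poly_apply S D x p =
     fold_coeffs (\<lambda>a y i. x i * quat_of_complex a + qapply S D y i) p (\<lambda>i. 0)"

lemma poly_apply_0 [simp]: "poly_apply S D x 0 = (\<lambda>i. 0)"
  by (simp add: poly_apply_def)

lemma poly_apply_pCons:
  "poly_apply S D x (pCons a p) =
     (\<lambda>i. x i * quat_of_complex a + qapply S D (poly_apply S D x p) i)"
  by (cases "p = 0 \<and> a = 0") (auto simp: poly_apply_def fun_eq_iff)

lemma poly_apply_add:
  "poly_apply S D x (p + q) = (\<lambda>i. poly_apply S D x p i + poly_apply S D x q i)"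
  by (induction p q rule: poly_induct2)
    (simp_all add: poly_apply_pCons qapply_add distrib_left add_ac)

lemma poly_apply_sum:
  "poly_apply S D x (\<Sum>t\<in>T. p t) = (\<lambda>i. \<Sum>t\<in>T. poly_apply S D x (p t) i)"
  by (induction T rule: infinite_finite_induct) (simp_all add: poly_apply_add)

text \<open>The factor can be moved to the far right because the coefficients come from a
  commutative copy of the complex numbers inside the quaternions.\<close>

lemma poly_apply_smult:
  "poly_apply S D x (smult c p) = (\<lambda>i. poly_apply S D x p i * quat_of_complex c)"
  by (induction p)
    (simp_all add: poly_apply_pCons qapply_mult_right distrib_right mult.assoc
      mult.commute[of c] flip: quat_of_complex_simps(4))

text \<open>If (X - c) p annihilates x, this makes p(D) x satisfy the eigenvector equation with
  right eigenvalue c.\<close>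

lemma poly_apply_linear_factor:
  "poly_apply S D x ([:- c, 1:] * p) i =
     qapply S D (poly_apply S D x p) i - poly_apply S D x p i * quat_of_complex c"
proof -
  have "[:- c, 1:] * p = pCons 0 p + smult (- c) p" by simp
  then show ?thesis
    by (simp only: poly_apply_add poly_apply_smult poly_apply_pCons) simp
qed

text \<open>A dimension count over the reals: the set \<open>E\<close> lists all real components of
  a vector on S, so the \<open>card E + 1\<close> vectors D^k x with k \<le> \<open>card E\<close>
  satisfy a real linear relation.\<close>

lemma annihilating_poly_exists:
  assumes "finite S"
  shows "\<exists>p. p \<noteq> 0 \<and> (\<forall>i\<in>S. poly_apply S D x p i = 0)"
proof -
  define E where "E = S \<times> {q_re, q_i, q_j, q_k}"
  define v where "v k = poly_apply S D x (monom 1 k)" for k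
  have finE: "finite E" using assms by (simp add: E_def)
  obtain c :: "nat \<Rightarrow> real" where nz: "\<exists>k\<in>{..card E}. c k \<noteq> 0"
    and c: "\<And>i h. (i, h) \<in> E \<Longrightarrow> (\<Sum>k\<le>card E. h (v k i) * c k) = 0"
    using homogeneous_system_solution[OF finE, of "{..card E}" "\<lambda>(i, h) k. h (v k i)"]
    by fastforce
  define p where "p = (\<Sum>k\<le>card E. smult (of_real (c k)) (monom 1 k) :: complex poly)"
  have "poly_apply S D x p i = (\<Sum>k\<le>card E. c k *\<^sub>R v k i)" for i
    by (simp add: p_def poly_apply_sum poly_apply_smult v_def del: smult_monom smult_conv_map_poly)
  then have "poly_apply S D x p i = 0" if "i \<in> S" for i
    using that c[of i] by (simp add: E_def quat_eq_iff quat_components_sum mult.commute)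
  moreover have "coeff p k = of_real (c k)" if "k \<le> card E" for k
    using that by (simp add: p_def coeff_sum if_distrib cong: if_cong)
  then have "p \<noteq> 0" using nz by fastforce
  ultimately show ?thesis by blast
qed

text \<open>The eigenvector is delivered in the form p(D) x, so that orthogonality relations of x
  which D preserves carry over to it.\<close>

lemma right_eigenvector_exists:
  assumes "finite S" and x: "\<exists>i\<in>S. x i \<noteq> 0"
  obtains p c where "\<exists>i\<in>S. poly_apply S D x p i \<noteq> 0"
    and "\<And>i. i \<in> S \<Longrightarrow> qapply S D (poly_apply S D x p) i = poly_apply S D x p i * c"
proof -
  let ?P = "\<lambda>p. p \<noteq> 0 \<and> (\<forall>i\<in>S. poly_apply S D x p i = 0)"
  obtain p where p: "?P p" and min: "\<And>q. degree q < degree p \<Longrightarrow> \<not> ?P q"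
    using ex_has_least_nat[of ?P _ degree] annihilating_poly_exists[OF assms(1), of D x]
    by (metis not_le)
  \<comment> \<open>A nonzero constant annihilating x would force x = 0 on S.\<close>
  have "degree p \<noteq> 0"
  proof
    assume "degree p = 0"
    then obtain c where "p = [:c:]" by (auto elim: degree_eq_zeroE)
    then show False using p x by (auto simp: poly_apply_pCons)
  qed
  then obtain c where "poly p c = 0"
    using fundamental_theorem_of_algebra[of p] by (auto simp: constant_degree)
  then obtain q where q: "p = [:- c, 1:] * q" by (auto simp: poly_eq_0_iff_dvd)
  then have "q \<noteq> 0" using p by auto
  then have "degree p = Suc (degree q)" unfolding q by (subst degree_mult_eq) auto
  \<comment> \<open>Splitting off a root lowers the degree, so by minimality the cofactor q does not
    annihilate x, while (X - c) q does.\<close>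
  then have "\<not> ?P q" using min by simp
  then have 1: "\<exists>i\<in>S. poly_apply S D x q i \<noteq> 0" using \<open>q \<noteq> 0\<close> by blast
  have 2: "qapply S D (poly_apply S D x q) i = poly_apply S D x q i * quat_of_complex c"
    if "i \<in> S" for i
    using p that poly_apply_linear_factor[of S D x c q i] unfolding q by simp
  from that[OF 1 2] show thesis .
qed

section \<open>The spectral theorem for skew-Hermitian quaternion matrices\<close>

lemma skew_unit_eigenvector:
  assumes "finite S" and skew: "skew_hermitian_on S D" and eta: "\<eta> \<in> {quat_i, quat_j, quat_k}"
    and x: "\<exists>i\<in>S. x i \<noteq> 0" and orth: "\<And>y. y \<in> Y \<Longrightarrow> qinner S y x = 0"
    and inv: "\<And>y. y \<in> Y \<Longrightarrow> \<exists>c. \<forall>i\<in>S. qapply S D y i = y i * c"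
  obtains z d where "qinner S z z = 1" "0 \<le> d" "\<And>y. y \<in> Y \<Longrightarrow> qinner S y z = 0"
    "\<And>i. i \<in> S \<Longrightarrow> qapply S D z i = z i * (d *\<^sub>R \<eta>)"
proof -
  \<comment> \<open>The orthogonal complement of an eigenvector y is invariant: by skewness, y pairs
    with D w to minus the conjugate eigenvalue times the pairing of y with w.\<close>
  have orth_poly: "qinner S y (poly_apply S D x p) = 0" if y: "y \<in> Y" for y p
  proof (induction p)
    case 0
    then show ?case by (simp add: qinner_def)
  next
    case (pCons a p)
    obtain c where c: "\<And>i. i \<in> S \<Longrightarrow> qapply S D y i = y i * c" using inv[OF y] by blast
    have "qinner S (qapply S D y) (poly_apply S D x p) = qinner S (\<lambda>i. y i * c) (poly_apply S D x p)"
      using c by (intro qinner_cong) auto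
    then show ?case
      using pCons orth[OF y]
      by (simp add: poly_apply_pCons qinner_add_right qinner_mult_right qinner_mult_left
          qinner_qapply_skew[OF skew])
  qed
  obtain p c where nz: "\<exists>i\<in>S. poly_apply S D x p i \<noteq> 0"
    and ev: "\<And>i. i \<in> S \<Longrightarrow> qapply S D (poly_apply S D x p) i = poly_apply S D x p i * c"
    using right_eigenvector_exists[OF assms(1) x, of D] by blast
  define v where "v = poly_apply S D x p"
  have v: "\<exists>i\<in>S. v i \<noteq> 0" "\<And>i. i \<in> S \<Longrightarrow> qapply S D v i = v i * c"
    using nz ev by (auto simp: v_def)
  \<comment> \<open>The pairing of v with D v is evaluated on both sides. Since the pairing of v
    with itself is real, hence central, and positive, it cancels and leaves c pure.\<close>
  have "qinner S v v * c = - (quat_cnj c * qinner S v v)"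
  proof -
    have "qinner S v (qapply S D v) = qinner S v (\<lambda>i. v i * c)"
      and "qinner S (qapply S D v) v = qinner S (\<lambda>i. v i * c) v"
      using v by (auto intro!: qinner_cong)
    then show ?thesis
      using qinner_qapply_skew[OF skew, of v v] by (simp add: qinner_mult_right qinner_mult_left)
  qed
  then have "(\<Sum>i\<in>S. quat_sqnorm (v i)) *\<^sub>R (quat_cnj c + c) = 0"
    unfolding qinner_self by (simp add: scaleR_add_right)
  then have "quat_cnj c = - c"
    using qinner_self_pos[OF assms(1) v(1)] by (simp add: eq_neg_iff_add_eq_0)
  then obtain q d where q: "q \<noteq> 0" "0 \<le> d" "c * q = q * (d *\<^sub>R \<eta>)"
    using pure_quat_similar_eta[OF eta] by blast
  \<comment> \<open>Rescaling by q on the right conjugates the eigenvalue c into d \<eta>; the later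
    real normalising factor is central and leaves it unchanged.\<close>
  define w where "w i = v i * q" for i
  have w: "\<exists>i\<in>S. w i \<noteq> 0" using v q by (auto simp: w_def)
  define s where "s = (\<Sum>i\<in>S. quat_sqnorm (w i))"
  have s: "0 < s" using qinner_self_pos[OF assms(1) w] by (simp add: s_def)
  define t where "t = 1 / sqrt s"
  define z where "z i = v i * (q * (t *\<^sub>R 1))" for i
  have zw: "z = (\<lambda>i. w i * (t *\<^sub>R 1))" by (simp add: z_def w_def fun_eq_iff)
  have "qinner S z z = (t * t * s) *\<^sub>R 1"
    unfolding zw qinner_mult_left qinner_mult_right qinner_self s_def[symmetric] by simp
  also have "t * t * s = 1"
    using s by (simp add: t_def)
  finally have "qinner S z z = 1" by simp
  moreover have "qinner S y z = 0" if "y \<in> Y" for y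
    using orth_poly[OF that, of p] unfolding z_def qinner_mult_right v_def by simp
  moreover have "qapply S D z i = z i * (d *\<^sub>R \<eta>)" if "i \<in> S" for i
  proof -
    have "qapply S D z i = v i * ((c * q) * (t *\<^sub>R 1))"
      unfolding z_def qapply_mult_right v(2)[OF that] by (simp add: mult.assoc)
    also have "\<dots> = z i * (d *\<^sub>R \<eta>)"
      unfolding q(3) z_def by (simp add: mult.assoc)
    finally show ?thesis .
  qed
  ultimately show thesis using that q(2) by blast
qed

section \<open>Orthonormal bases of eigenvectors\<close>

definition orthonormal_on :: "'a set \<Rightarrow> 'k set \<Rightarrow> ('k \<Rightarrow> 'a \<Rightarrow> quat) \<Rightarrow> bool" where
  "orthonormal_on S K y \<longleftrightarrow> (\<forall>k\<in>K. \<forall>l\<in>K. qinner S (y k) (y l) = (if k = l then 1 else 0))"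

lemma skew_orthonormal_eigenvectors:
  assumes "finite S" and skew: "skew_hermitian_on S D" and eta: "\<eta> \<in> {quat_i, quat_j, quat_k}"
    and "n \<le> card S"
  shows "\<exists>y d. orthonormal_on S {..<n} y \<and> (\<forall>k<n. 0 \<le> d k) \<and>
     (\<forall>k<n. \<forall>i\<in>S. qapply S D (y k) i = y k i * (d k *\<^sub>R \<eta>))"
  using assms(4)
proof (induction n)
  case 0
  then show ?case by (simp add: orthonormal_on_def)
next
  case (Suc n)
  then obtain y d where on: "orthonormal_on S {..<n} y" and d: "\<And>k. k < n \<Longrightarrow> 0 \<le> (d k :: real)"
    and ev: "\<And>k i. k < n \<Longrightarrow> i \<in> S \<Longrightarrow> qapply S D (y k) i = y k i * (d k *\<^sub>R \<eta>)"
    using Suc.IH by (meson Suc_leD)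
  \<comment> \<open>Orthogonality to the n vectors found so far amounts to n homogeneous equations
    in more than n unknowns.\<close>
  obtain x where x: "\<exists>i\<in>S. x i \<noteq> 0" "\<And>k. k < n \<Longrightarrow> qinner S (y k) x = 0"
    using homogeneous_system_solution[of "{..<n}" S "\<lambda>k i. quat_cnj (y k i)"] Suc.prems assms(1)
    by (auto simp: qinner_def)
  obtain z e where z: "qinner S z z = 1" "0 \<le> e" "\<And>k. k < n \<Longrightarrow> qinner S (y k) z = 0"
    "\<And>i. i \<in> S \<Longrightarrow> qapply S D z i = z i * (e *\<^sub>R \<eta>)"
  proof (rule skew_unit_eigenvector[OF assms(1) skew eta x(1), of "y ` {..<n}"])
    show "qinner S v x = 0" if "v \<in> y ` {..<n}" for v using that x(2) by auto
    show "\<exists>c. \<forall>i\<in>S. qapply S D v i = v i * c" if "v \<in> y ` {..<n}" for v using that ev by blast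
  qed blast
  have zy: "qinner S z (y k) = 0" if "k < n" for k
    using z(3)[OF that] qinner_cnj[of S "y k" z] by simp
  have "orthonormal_on S {..<Suc n} (y(n := z))"
    using on z(1,3) zy by (auto simp: orthonormal_on_def less_Suc_eq)
  moreover have "\<forall>k<Suc n. 0 \<le> (d(n := e)) k" using d z(2) by (auto simp: less_Suc_eq)
  moreover have "\<forall>k<Suc n. \<forall>i\<in>S. qapply S D ((y(n := z)) k) i
      = (y(n := z)) k i * ((d(n := e)) k *\<^sub>R \<eta>)"
    using ev z(4) by (auto simp: less_Suc_eq)
  ultimately show ?case by blast
qed

text \<open>Orthonormality of the columns of a square matrix implies that of its rows. The j-th
  standard basis vector and the family are too many vectors to be independent, and pairing a
  relation with \<open>y k\<close> determines its coefficients.\<close>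

lemma orthonormal_complete:
  fixes y :: "'k \<Rightarrow> 'a \<Rightarrow> quat"
  assumes "finite S" "finite K" "card K = card S" and on: "orthonormal_on S K y"
    and i: "i \<in> S" and j: "j \<in> S"
  shows "(\<Sum>k\<in>K. y k i * quat_cnj (y k j)) = (if i = j then 1 else 0)"
proof -
  define e where "e i = (if i = j then 1 else (0 :: quat))" for i
  \<comment> \<open>\<open>None\<close> labels the standard basis vector \<open>e\<close>, and
    \<open>Some k\<close> the k-th member of the family.\<close>
  define v where "v t = (case t of None \<Rightarrow> e | Some k \<Rightarrow> y k)" for t
  let ?T = "insert None (Some ` K)"
  have "card S < card ?T" using assms by (simp add: card_image)
  then obtain c where nz: "\<exists>t\<in>?T. c t \<noteq> 0" and c: "\<And>i. i \<in> S \<Longrightarrow> (\<Sum>t\<in>?T. v t i * c t) = 0"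
    using homogeneous_system_solution[of S ?T "\<lambda>i t. v t i"] assms(1,2) by auto
  have c': "e i * c None + (\<Sum>k\<in>K. y k i * c (Some k)) = 0" if "i \<in> S" for i
    using c[OF that] assms(2) by (simp add: v_def sum.reindex)
  have ye: "qinner S (y k) e = quat_cnj (y k j)" for k
    using assms(1) j by (simp add: qinner_def e_def if_distrib cong: if_cong)
  have ck: "c (Some k) = - (quat_cnj (y k j) * c None)" if "k \<in> K" for k
  proof -
    have "qinner S (y k) (\<lambda>i. e i * c None + (\<Sum>l\<in>K. y l i * c (Some l))) = qinner S (y k) (\<lambda>i. 0)"
      using c' by (intro qinner_cong) auto
    also have "\<dots> = 0" by (simp add: qinner_def)
    finally have "quat_cnj (y k j) * c None + (\<Sum>l\<in>K. qinner S (y k) (y l) * c (Some l)) = 0"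
      by (simp add: qinner_add_right qinner_mult_right qinner_sum_right ye)
    also have "(\<Sum>l\<in>K. qinner S (y k) (y l) * c (Some l)) = (\<Sum>l\<in>K. if k = l then c (Some l) else 0)"
      using on that by (intro sum.cong) (auto simp: orthonormal_on_def)
    also have "\<dots> = c (Some k)" using assms(2) that by simp
    finally show ?thesis by (simp add: eq_neg_iff_add_eq_0 add.commute)
  qed
  \<comment> \<open>By \<open>ck\<close>, all other coefficients vanish together with this
    one.\<close>
  have "c None \<noteq> 0" using nz ck by auto
  moreover have "(e i - (\<Sum>k\<in>K. y k i * quat_cnj (y k j))) * c None = 0"
    using c'[OF i] ck by (simp add: left_diff_distrib sum_distrib_right sum_negf mult.assoc)
  ultimately show ?thesis by (simp add: e_def)
qed

text \<open>Moves the positive eigenvalues to the front, as the block form of a singular value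
  decomposition requires, and passes from numbering from 0 to numbering from 1.\<close>

lemma nonzero_first_reindexing:
  fixes d :: "nat \<Rightarrow> real"
  assumes "\<And>k. k < n \<Longrightarrow> 0 \<le> d k"
  obtains \<pi> r where "bij_betw \<pi> {1..n} {..<n}" "r \<le> n"
    "\<And>m. m \<in> {1..n} \<Longrightarrow> m \<le> r \<Longrightarrow> 0 < d (\<pi> m)" "\<And>m. m \<in> {1..n} \<Longrightarrow> r < m \<Longrightarrow> d (\<pi> m) = 0"
proof -
  let ?P = "{k. k < n \<and> 0 < d k}" and ?Z = "{k. k < n \<and> d k = 0}"
  define r where "r = card ?P"
  have un: "?P \<union> ?Z = {..<n}" using assms by (auto simp: less_le)
  have dis: "?P \<inter> ?Z = {}" by auto
  have "card ?P + card ?Z = n" using card_Un_disjoint[of ?P ?Z] dis un by auto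
  then have r: "r \<le> n" "card ?Z = n - r" by (auto simp: r_def)
  obtain f where f: "bij_betw f {1..r} ?P"
    using finite_same_card_bij[of "{1..r}" ?P] by (auto simp: r_def)
  obtain g where g: "bij_betw g {Suc r..n} ?Z"
    using finite_same_card_bij[of "{Suc r..n}" ?Z] r by auto
  define \<pi> where "\<pi> m = (if m \<le> r then f m else g m)" for m
  have f': "bij_betw \<pi> {1..r} ?P" using f by (rule bij_betw_cong[THEN iffD1, rotated]) (auto simp: \<pi>_def)
  have g': "bij_betw \<pi> {Suc r..n} ?Z" using g by (rule bij_betw_cong[THEN iffD1, rotated]) (auto simp: \<pi>_def)
  have "{1..r} \<union> {Suc r..n} = {1..n}" using r by auto
  then have "bij_betw \<pi> {1..n} {..<n}"
    using bij_betw_combine[OF f' g' dis] un by simp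
  then show thesis
    using that[of \<pi> r] r bij_betwE[OF f'] bij_betwE[OF g'] by auto
qed

text \<open>In matrix terms D = Y diag(d \<eta>) Y^* with Y unitary; the sum stops at
  \<open>r\<close> because the remaining eigenvalues are zero.\<close>

theorem skew_hermitian_spectral:
  assumes "finite S" and skew: "skew_hermitian_on S D" and eta: "\<eta> \<in> {quat_i, quat_j, quat_k}"
  obtains y d r where "r \<le> card S" "orthonormal_on S {1..card S} y"
    "\<And>i j. i \<in> S \<Longrightarrow> j \<in> S \<Longrightarrow>
       (\<Sum>m=1..card S. y m i * quat_cnj (y m j)) = (if i = j then 1 else 0)"
    "\<And>m. m \<in> {1..r} \<Longrightarrow> 0 < d m"
    "\<And>i j. i \<in> S \<Longrightarrow> j \<in> S \<Longrightarrow> D i j = (\<Sum>m=1..r. y m i * (d m *\<^sub>R \<eta>) * quat_cnj (y m j))"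
proof -
  let ?n = "card S"
  obtain y0 d0 where y0: "orthonormal_on S {..<?n} y0" and d0: "\<And>k. k < ?n \<Longrightarrow> 0 \<le> (d0 k :: real)"
    and ev0: "\<And>k i. k < ?n \<Longrightarrow> i \<in> S \<Longrightarrow> qapply S D (y0 k) i = y0 k i * (d0 k *\<^sub>R \<eta>)"
    using skew_orthonormal_eigenvectors[OF assms order_refl] by blast
  obtain \<pi> r where pi: "bij_betw \<pi> {1..?n} {..<?n}" and r: "r \<le> ?n"
    and pos: "\<And>m. m \<in> {1..?n} \<Longrightarrow> m \<le> r \<Longrightarrow> 0 < d0 (\<pi> m)"
    and zero: "\<And>m. m \<in> {1..?n} \<Longrightarrow> r < m \<Longrightarrow> d0 (\<pi> m) = 0"
    using nonzero_first_reindexing[of ?n d0] d0 by blast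
  define y where "y = y0 \<circ> \<pi>"
  define d where "d = d0 \<circ> \<pi>"
  have pi_in: "\<pi> m < ?n" if "m \<in> {1..?n}" for m using bij_betwE[OF pi] that by auto
  have pi_inj: "\<pi> m = \<pi> m' \<longleftrightarrow> m = m'" if "m \<in> {1..?n}" "m' \<in> {1..?n}" for m m'
    using bij_betw_imp_inj_on[OF pi] that by (auto dest: inj_onD)
  have on: "orthonormal_on S {1..?n} y"
    unfolding orthonormal_on_def y_def
    using y0 pi_in pi_inj by (auto simp: orthonormal_on_def)
  have compl: "(\<Sum>m=1..?n. y m i * quat_cnj (y m j)) = (if i = j then 1 else 0)"
    if "i \<in> S" "j \<in> S" for i j
    using orthonormal_complete[OF assms(1) _ _ on that] by simp
  have "D i j = (\<Sum>m=1..r. y m i * (d m *\<^sub>R \<eta>) * quat_cnj (y m j))" if i: "i \<in> S" and j: "j \<in> S" for i j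
  proof -
    \<comment> \<open>Inserting Y Y^* for the identity gives D = (D Y) Y^*, and D Y is known from
      the eigenvector equations.\<close>
    have "D i j = (\<Sum>k\<in>S. D i k * (if k = j then 1 else 0))"
      using assms(1) j by (simp add: if_distrib cong: if_cong)
    also have "\<dots> = (\<Sum>k\<in>S. \<Sum>m=1..?n. D i k * y m k * quat_cnj (y m j))"
      by (intro sum.cong refl) (simp add: compl[OF _ j, symmetric] sum_distrib_left mult.assoc)
    also have "\<dots> = (\<Sum>m=1..?n. \<Sum>k\<in>S. D i k * y m k * quat_cnj (y m j))"
      by (rule sum.swap)
    also have "\<dots> = (\<Sum>m=1..?n. y m i * (d m *\<^sub>R \<eta>) * quat_cnj (y m j))"
    proof (rule sum.cong[OF refl])
      fix m assume "m \<in> {1..?n}"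
      then have "qapply S D (y m) i = y m i * (d m *\<^sub>R \<eta>)"
        using ev0[OF pi_in i] by (simp add: y_def d_def)
      then show "(\<Sum>k\<in>S. D i k * y m k * quat_cnj (y m j)) = y m i * (d m *\<^sub>R \<eta>) * quat_cnj (y m j)"
        by (simp only: qapply_def flip: sum_distrib_right)
    qed
    also have "\<dots> = (\<Sum>m=1..r. y m i * (d m *\<^sub>R \<eta>) * quat_cnj (y m j))"
      using r zero by (intro sum.mono_neutral_right) (auto simp: d_def)
    finally show ?thesis .
  qed
  then show thesis using that[of r y d] r on compl pos by (auto simp: d_def)
qed

section \<open>The rank of a quaternion matrix with a singular value decomposition\<close>

text \<open>The columns of A and the first \<open>r\<close> columns of U are right combinations of
  each other, and the latter are independent, so a maximal independent set of columns of A has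
  \<open>r\<close> elements.\<close>

lemma quat_rank_svd:
  assumes U: "unitary_quat_mat m U" and V: "unitary_quat_mat n V" and r: "r \<le> m" "r \<le> n"
    and d: "\<And>k. k \<in> {1..r} \<Longrightarrow> d k \<noteq> 0"
    and A: "A = U * diag_block_mat m n r d * quat_adjoint V"
  shows "quat_rank A = r"
proof -
  have carr: "U \<in> carrier_mat m m" "V \<in> carrier_mat n n"
    using U V by (auto simp: unitary_quat_mat_def)
  have dimA: "dim_row A = m" "dim_col A = n" using carr by (auto simp: A quat_adjoint_def)
  let ?a = "\<lambda>i j. A $$ (i, j)" and ?u = "\<lambda>i k. U $$ (i, k)" and ?v = "\<lambda>j k. V $$ (j, k)"
  have entry: "?a i j = (\<Sum>k<r. ?u i k * (d (k + 1) *\<^sub>R quat_cnj (?v j k)))"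
    if "i < m" "j < n" for i j
  proof -
    have "(U * diag_block_mat m n r d) $$ (i, l) = (if l < r then d (l + 1) *\<^sub>R ?u i l else 0)"
      if "l < n" for l
    proof -
      have "(U * diag_block_mat m n r d) $$ (i, l)
          = (\<Sum>k\<in>{0..<m}. ?u i k * (if k = l \<and> k < r then of_real (d (k + 1)) else 0))"
        using carr \<open>i < m\<close> that by (simp add: scalar_prod_def diag_block_mat_def)
      also have "\<dots> = (\<Sum>k\<in>{0..<m}. if k = l then (if l < r then d (l + 1) *\<^sub>R ?u i l else 0) else 0)"
        by (intro sum.cong) (auto simp: of_real_def)
      finally show ?thesis using r by auto
    qed
    then have "?a i j = (\<Sum>l\<in>{0..<n}. (if l < r then d (l + 1) *\<^sub>R ?u i l else 0) * quat_cnj (?v j l))"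
      using carr that by (simp add: A scalar_prod_def quat_adjoint_def diag_block_mat_def)
    also have "\<dots> = (\<Sum>l<r. (if l < r then d (l + 1) *\<^sub>R ?u i l else 0) * quat_cnj (?v j l))"
      using r by (intro sum.mono_neutral_right) auto
    finally show ?thesis by simp
  qed
  have orth: "(\<Sum>i<p. quat_cnj (W $$ (i, k)) * W $$ (i, l)) = (if k = l then 1 else 0)"
    if "unitary_quat_mat p W" "k < p" "l < p" for p W k l
  proof -
    have W: "W \<in> carrier_mat p p" "quat_adjoint W * W = 1\<^sub>m p"
      using that by (auto simp: unitary_quat_mat_def)
    have "(quat_adjoint W * W) $$ (k, l) = (\<Sum>i<p. quat_cnj (W $$ (i, k)) * W $$ (i, l))"
      using W(1) that by (simp add: scalar_prod_def quat_adjoint_def atLeast0LessThan)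
    then show ?thesis using W(2) that by simp
  qed
  \<comment> \<open>The relation A V = U diag(d), solved for the k-th column of U.\<close>
  have u_eq: "?u i k = (\<Sum>j<n. ?a i j * (inverse (d (k + 1)) *\<^sub>R ?v j k))" if "i < m" "k < r" for i k
  proof -
    have "(\<Sum>j<n. ?a i j * (inverse (d (k + 1)) *\<^sub>R ?v j k))
        = (\<Sum>j<n. \<Sum>l<r. (inverse (d (k + 1)) * d (l + 1)) *\<^sub>R (?u i l * (quat_cnj (?v j l) * ?v j k)))"
      using that by (intro sum.cong) (auto simp: entry sum_distrib_right scaleR_sum_right mult.assoc)
    also have "\<dots> = (\<Sum>l<r. (inverse (d (k + 1)) * d (l + 1)) *\<^sub>R
        (?u i l * (\<Sum>j<n. quat_cnj (?v j l) * ?v j k)))"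
      unfolding sum_distrib_left scaleR_sum_right by (rule sum.swap)
    also have "\<dots> = (\<Sum>l<r. if l = k then ?u i k else 0)"
      using that r d by (intro sum.cong) (auto simp: orth[OF V])
    finally show ?thesis using that by simp
  qed
  have ind_u: "right_indep {..<m} {..<r} ?u"
    unfolding right_indep_def
  proof (intro allI impI ballI)
    fix c l assume c: "\<forall>i\<in>{..<m}. (\<Sum>k<r. ?u i k * c k) = 0" and l: "l \<in> {..<r}"
    have "0 = (\<Sum>i<m. quat_cnj (?u i l) * (\<Sum>k<r. ?u i k * c k))" using c by simp
    also have "\<dots> = (\<Sum>k<r. \<Sum>i<m. quat_cnj (?u i l) * ?u i k * c k)"
      unfolding sum_distrib_left mult.assoc by (rule sum.swap)
    also have "\<dots> = (\<Sum>k<r. (\<Sum>i<m. quat_cnj (?u i l) * ?u i k) * c k)"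
      by (simp only: sum_distrib_right)
    also have "\<dots> = (\<Sum>k<r. if k = l then c l else 0)"
      using l r by (intro sum.cong) (auto simp: orth[OF U])
    finally show "c l = 0" using l by simp
  qed
  let ?F = "{S. S \<subseteq> {..<n} \<and> right_indep {..<m} S ?a}"
  have rank: "quat_rank A = Max (card ` ?F)"
    unfolding quat_rank_def right_indep_cols_def right_indep_def dimA by (simp only: Ball_def lessThan_iff)
  have "finite ?F" by (rule finite_subset[of _ "Pow {..<n}"]) auto
  then have fin: "finite (card ` ?F)" by (rule finite_imageI)
  have "{} \<in> ?F" by (simp add: right_indep_def)
  then have "Max (card ` ?F) \<in> card ` ?F" using fin by (intro Max_in) auto
  then obtain S where S: "S \<subseteq> {..<n}" "right_indep {..<m} S ?a" and card_S: "card S = quat_rank A"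
    unfolding rank by auto
  have finS: "finite S" using S(1) finite_subset by blast
  have "card S \<le> card {..<r}"
  proof (rule right_indep_card_le[OF _ finS S(2)])
    show "?a i j = (\<Sum>k<r. ?u i k * (d (k + 1) *\<^sub>R quat_cnj (?v j k)))"
      if "i \<in> {..<m}" "j \<in> S" for i j
      using that S(1) by (intro entry) auto
  qed simp
  moreover have "card {..<r} \<le> card S"
  proof -
    \<comment> \<open>Maximality of S makes every column of A a combination of those in S; hence the
      columns of U are such combinations as well.\<close>
    have "\<exists>g. \<forall>i\<in>{..<m}. ?a i j = (\<Sum>s\<in>S. ?a i s * g s)" if "j < n" for j
    proof (cases "j \<in> S")
      case True
      then show ?thesis
        using finS by (intro exI[of _ "\<lambda>s. if s = j then 1 else 0"]) (simp add: if_distrib cong: if_cong)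
    next
      case False
      have "\<not> right_indep {..<m} (insert j S) ?a"
      proof
        assume "right_indep {..<m} (insert j S) ?a"
        then have "card (insert j S) \<in> card ` ?F" using S(1) that by auto
        then have "card (insert j S) \<le> card S" unfolding card_S rank using fin by (rule Max_ge[rotated])
        then show False using False finS by simp
      qed
      then show ?thesis using right_indep_insert[OF finS False S(2)] by blast
    qed
    then have "\<forall>j\<in>{..<n}. \<exists>g. \<forall>i\<in>{..<m}. ?a i j = (\<Sum>s\<in>S. ?a i s * g s)" by blast
    then obtain g where "\<forall>j\<in>{..<n}. \<forall>i\<in>{..<m}. ?a i j = (\<Sum>s\<in>S. ?a i s * g j s)"
      by (rule bchoice[THEN exE])
    then have g: "?a i j = (\<Sum>s\<in>S. ?a i s * g j s)" if "i < m" "j < n" for i j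
      using that by blast
    have span: "?u i k = (\<Sum>s\<in>S. ?a i s * (\<Sum>j<n. g j s * (inverse (d (k + 1)) *\<^sub>R ?v j k)))"
      if "i < m" "k < r" for i k
    proof -
      have "?u i k = (\<Sum>j<n. \<Sum>s\<in>S. ?a i s * (g j s * (inverse (d (k + 1)) *\<^sub>R ?v j k)))"
        unfolding u_eq[OF that] using that(1)
        by (intro sum.cong refl) (simp add: g[OF that(1)] sum_distrib_right scaleR_sum_right mult.assoc)
      also have "\<dots> = (\<Sum>s\<in>S. ?a i s * (\<Sum>j<n. g j s * (inverse (d (k + 1)) *\<^sub>R ?v j k)))"
        unfolding sum_distrib_left by (rule sum.swap)
      finally show ?thesis .
    qed
    show ?thesis
      by (rule right_indep_card_le[OF finS _ ind_u]) (use span in auto)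
  qed
  ultimately show ?thesis using card_S by simp
qed

section \<open>The transformation \<open>f\<close> respects the tensor operations\<close>

lemma flatten_dims [simp]:
  "dim_row (flatten N I J A) = (\<Prod>k=1..N. I k)" "dim_col (flatten N I J A) = (\<Prod>k=1..N. J k)"
  by (simp_all add: flatten_def)

text \<open>\<open>pos_index\<close> inverts the numbering of multi-indices, so it can stand for the
  inverse in \<open>flatten\<close>; the shifts account for matrix indices starting at 0.\<close>

lemma flatten_index:
  assumes "1 \<le> N" "a < (\<Prod>k=1..N. I k)" "b < (\<Prod>k=1..N. J k)"
  shows "flatten N I J A $$ (a, b) = A (pos_index N I (a + 1)) (pos_index N J (b + 1))"
  using flatten_entry[OF assms(1) pos_index_in(1)[OF assms(1)] pos_index_in(1)[OF assms(1)],
      of "a + 1" I "b + 1" J A] pos_index_in(2)[OF assms(1), of "a + 1" I]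
    pos_index_in(2)[OF assms(1), of "b + 1" J] assms(2,3) by simp

text \<open>Reindexing along this bijection turns the contraction over multi-indices into an
  ordinary matrix product.\<close>

lemma bij_betw_pos_index:
  assumes "1 \<le> N"
  shows "bij_betw (\<lambda>a. pos_index N I (a + 1)) {0..<\<Prod>k=1..N. I k} (multi_indices N I)"
proof (rule bij_betw_byWitness[where f' = "\<lambda>i. lin_index N I i - 1"])
  show "\<forall>a\<in>{0..<\<Prod>k=1..N. I k}. lin_index N I (pos_index N I (a + 1)) - 1 = a"
    using pos_index_in(2)[OF assms, of _ I] by simp
  show "\<forall>i\<in>multi_indices N I. pos_index N I (lin_index N I i - 1 + 1) = i"
  proof
    fix i assume i: "i \<in> multi_indices N I"
    then have "lin_index N I i - 1 + 1 = lin_index N I i"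
      using lin_index_range[OF assms i] by simp
    then show "pos_index N I (lin_index N I i - 1 + 1) = i"
      using pos_index_lin_index[OF assms i] by simp
  qed
  show "(\<lambda>a. pos_index N I (a + 1)) ` {0..<\<Prod>k=1..N. I k} \<subseteq> multi_indices N I"
    using pos_index_in(1)[OF assms, of _ I] by auto
  show "(\<lambda>i. lin_index N I i - 1) ` multi_indices N I \<subseteq> {0..<\<Prod>k=1..N. I k}"
    using lin_index_range[OF assms, of _ I] by fastforce
qed

lemma flatten_einstein_prod:
  assumes "1 \<le> N"
  shows "flatten N I K (einstein_prod N J A B) = flatten N I J A * flatten N J K B"
proof (rule eq_matI)
  fix a b assume "a < dim_row (flatten N I J A * flatten N J K B)"
    "b < dim_col (flatten N I J A * flatten N J K B)"
  then have ab: "a < (\<Prod>k=1..N. I k)" "b < (\<Prod>k=1..N. K k)" by auto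
  have "flatten N I K (einstein_prod N J A B) $$ (a, b)
      = (\<Sum>j\<in>multi_indices N J. A (pos_index N I (a + 1)) j * B j (pos_index N K (b + 1)))"
    using ab by (simp only: flatten_index[OF assms] einstein_prod_def)
  also have "\<dots> = (\<Sum>c\<in>{0..<\<Prod>k=1..N. J k}. A (pos_index N I (a + 1)) (pos_index N J (c + 1))
      * B (pos_index N J (c + 1)) (pos_index N K (b + 1)))"
    by (rule sum.reindex_bij_betw[OF bij_betw_pos_index[OF assms], symmetric])
  also have "\<dots> = (flatten N I J A * flatten N J K B) $$ (a, b)"
    using ab by (simp add: scalar_prod_def flatten_index[OF assms])
  finally show "flatten N I K (einstein_prod N J A B) $$ (a, b)
      = (flatten N I J A * flatten N J K B) $$ (a, b)" .
qed auto

lemma flatten_conj_transpose: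
  assumes "1 \<le> N"
  shows "flatten N J I (conj_transpose A) = quat_adjoint (flatten N I J A)"
  by (rule eq_matI) (simp_all add: quat_adjoint_def flatten_index[OF assms] conj_transpose_def)

lemma flatten_unit_tensor:
  assumes "1 \<le> N"
  shows "flatten N I I (unit_tensor N I) = 1\<^sub>m (\<Prod>k=1..N. I k)"
proof (rule eq_matI)
  let ?n = "\<Prod>k=1..N. I k"
  fix a b assume "a < dim_row (1\<^sub>m ?n)" "b < dim_col (1\<^sub>m ?n)"
  then have ab: "a < ?n" "b < ?n" by auto
  then have "pos_index N I (a + 1) = pos_index N I (b + 1) \<longleftrightarrow> a = b"
    using bij_betw_imp_inj_on[OF bij_betw_pos_index[OF assms, of I]] by (auto dest: inj_onD)
  then show "flatten N I I (unit_tensor N I) $$ (a, b) = 1\<^sub>m ?n $$ (a, b)"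
    using ab pos_index_in(1)[OF assms, of "a + 1" I]
    by (simp add: flatten_index[OF assms] unit_tensor_def)
qed auto

lemma unitary_flatten:
  assumes "1 \<le> N" "unitary_tensor N I U"
  shows "unitary_quat_mat (\<Prod>k=1..N. I k) (flatten N I I U)"
  unfolding unitary_quat_mat_def
proof (intro conjI)
  show "flatten N I I U \<in> carrier_mat (\<Prod>k=1..N. I k) (\<Prod>k=1..N. I k)"
    by (intro carrier_matI) simp_all
  show "flatten N I I U * quat_adjoint (flatten N I I U) = 1\<^sub>m (\<Prod>k=1..N. I k)"
    "quat_adjoint (flatten N I I U) * flatten N I I U = 1\<^sub>m (\<Prod>k=1..N. I k)"
    using assms(2) flatten_unit_tensor[OF assms(1), of I]
    unfolding unitary_tensor_def flatten_conj_transpose[OF assms(1), symmetric]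
      flatten_einstein_prod[OF assms(1), symmetric] by simp_all
qed

text \<open>The entries are -\<eta> u \<eta> = \<eta> u \<eta>^(-1). Conjugation by \<eta> is a ring
  automorphism that commutes with quaternion conjugation, so it preserves both unitarity
  equations.\<close>

lemma unitary_conj_transpose_eta_adjoint:
  assumes "\<eta> \<in> {quat_i, quat_j, quat_k}" "unitary_tensor N I U"
  shows "unitary_tensor N I (conj_transpose (eta_adjoint \<eta> U))"
proof -
  note eta = eta_props[OF assms(1)]
  let ?V = "conj_transpose (eta_adjoint \<eta> U)"
  have V: "?V i j = - (\<eta> * U i j * \<eta>)" for i j
    by (simp add: conj_transpose_def eta_adjoint_def quat_cnj_mult eta mult.assoc)
  have cV: "conj_transpose ?V i j = - (\<eta> * conj_transpose U i j * \<eta>)" for i j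
    by (simp add: conj_transpose_def eta_adjoint_def)
  have conj: "- (\<eta> * p * \<eta>) * - (\<eta> * q * \<eta>) = - (\<eta> * (p * q) * \<eta>)" for p q
  proof -
    have "- (\<eta> * p * \<eta>) * - (\<eta> * q * \<eta>) = \<eta> * p * (\<eta> * \<eta>) * q * \<eta>"
      by (simp only: minus_mult_minus mult.assoc)
    then show ?thesis by (simp add: eta mult.assoc)
  qed
  have "einstein_prod N I ?V (conj_transpose ?V) i k
      = - (\<eta> * einstein_prod N I U (conj_transpose U) i k * \<eta>)"
    "einstein_prod N I (conj_transpose ?V) ?V i k
      = - (\<eta> * einstein_prod N I (conj_transpose U) U i k * \<eta>)" for i k
    unfolding einstein_prod_def V cV conj
    by (simp_all add: sum_negf sum_distrib_left sum_distrib_right)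
  moreover have "- (\<eta> * unit_tensor N I i k * \<eta>) = unit_tensor N I i k" for i k
    by (simp add: unit_tensor_def eta)
  ultimately have "einstein_prod N I ?V (conj_transpose ?V) = unit_tensor N I"
    "einstein_prod N I (conj_transpose ?V) ?V = unit_tensor N I"
    using assms(2) by (auto simp: unitary_tensor_def fun_eq_iff)
  moreover have "?V \<in> tensors N I N I"
    using assms(2) by (auto simp: unitary_tensor_def tensors_def V)
  ultimately show ?thesis by (simp add: unitary_tensor_def)
qed

section \<open>Decomposition of an \<eta>-Hermitian tensor\<close>

theorem theorem3p7:
  fixes N r :: nat and I :: "nat \<Rightarrow> nat" and \<eta> :: quat and A :: "quat tensor"
  assumes "1 \<le> N" and "\<And>k. k \<in> {1..N} \<Longrightarrow> 1 \<le> I k"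
    and "\<eta> \<in> {quat_i, quat_j, quat_k}"
    and "A \<in> tensors N I N I"
    and "A = eta_adjoint \<eta> A"
    and "r = quat_rank (flatten N I I A)"
  shows "\<exists>(U :: quat tensor) (B :: real tensor) (d :: nat \<Rightarrow> real).
    unitary_tensor N I U \<and>
    B \<in> tensors N I N I \<and>
    nonzero_singular_values (flatten N I I A) r d \<and>
    (\<forall>m\<in>{1..r}. B (pos_index N I m) (pos_index N I m) = d m) \<and>
    (\<forall>i\<in>multi_indices N I. \<forall>j\<in>multi_indices N I.
       \<not> (\<exists>m\<in>{1..r}. i = pos_index N I m \<and> j = pos_index N I m) \<longrightarrow> B i j = 0) \<and>
    A = einstein_prod N I (einstein_prod N I U (of_real_tensor B)) (eta_adjoint \<eta> U)"
proof -
  note eta = eta_props[OF assms(3)]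
  define S where "S = multi_indices N I"
  define n where "n = (\<Prod>k=1..N. I k)"
  let ?lin = "lin_index N I" and ?pos = "pos_index N I"
  have lin: "bij_betw ?lin S {1..n}"
    unfolding S_def n_def by (rule bij_betw_lin_index[OF assms(1)])
  have card_S: "card S = n" using bij_betw_same_card[OF lin] by simp
  have finS: "finite S" using bij_betw_finite[OF lin] by simp
  have lin_in: "?lin i \<in> {1..n}" if "i \<in> S" for i using bij_betwE[OF lin] that by blast
  have pos_lin: "?pos (?lin i) = i" if "i \<in> S" for i
    using pos_index_lin_index[OF assms(1)] that by (simp add: S_def)
  have pos_in: "?pos m \<in> S" "?lin (?pos m) = m" if "m \<in> {1..n}" for m
    using pos_index_in[OF assms(1), of m I] that by (simp_all add: S_def n_def)
  have A_eta: "A j i = - (\<eta> * quat_cnj (A i j) * \<eta>)" for i j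
    using fun_cong[OF fun_cong[OF assms(5)], of j i] by (simp add: eta_adjoint_def conj_transpose_def)
  have skew: "skew_hermitian_on S (\<lambda>i j. A i j * \<eta>)"
    unfolding skew_hermitian_on_def
  proof (intro ballI)
    fix i j assume "i \<in> S" "j \<in> S"
    have "A j i * \<eta> = - (\<eta> * quat_cnj (A i j) * (\<eta> * \<eta>))"
      unfolding A_eta[of j i] by (simp only: mult.assoc mult_minus_left)
    then show "A j i * \<eta> = - quat_cnj (A i j * \<eta>)"
      by (simp add: eta quat_cnj_mult)
  qed
  obtain y d s where s: "s \<le> n" and on: "orthonormal_on S {1..n} y"
    and compl: "\<And>i j. i \<in> S \<Longrightarrow> j \<in> S \<Longrightarrow>
       (\<Sum>m=1..n. y m i * quat_cnj (y m j)) = (if i = j then 1 else 0)"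
    and pos: "\<And>m. m \<in> {1..s} \<Longrightarrow> 0 < d m"
    and D: "\<And>i j. i \<in> S \<Longrightarrow> j \<in> S \<Longrightarrow>
       A i j * \<eta> = (\<Sum>m=1..s. y m i * (d m *\<^sub>R \<eta>) * quat_cnj (y m j))"
    by (rule skew_hermitian_spectral[OF finS skew assms(3), unfolded card_S]) (rule that)
  \<comment> \<open>The eigenvectors become columns, with column multi-index j holding the
    eigenvector numbered \<open>?lin j\<close>; the value 0 outside the index range makes U a
    tensor.\<close>
  define U where "U i j = (if i \<in> S \<and> j \<in> S then y (?lin j) i else 0)" for i j
  \<comment> \<open>The condition \<open>?lin i \<le> s\<close> selects exactly the positions p^1,
    ..., p^s.\<close>
  define B where "B i j = (if i = j \<and> i \<in> S \<and> ?lin i \<le> s then d (?lin i) else 0)" for i j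
  have U: "unitary_tensor N I U"
    unfolding unitary_tensor_def
  proof (intro conjI ext)
    show "U \<in> tensors N I N I" by (auto simp: tensors_def U_def S_def)
    fix i k
    show "einstein_prod N I U (conj_transpose U) i k = unit_tensor N I i k"
    proof (cases "i \<in> S \<and> k \<in> S")
      case True
      then have "einstein_prod N I U (conj_transpose U) i k
          = (\<Sum>j\<in>S. y (?lin j) i * quat_cnj (y (?lin j) k))"
        by (simp add: einstein_prod_def conj_transpose_def U_def S_def)
      also have "\<dots> = (\<Sum>m=1..n. y m i * quat_cnj (y m k))"
        by (rule sum.reindex_bij_betw[OF lin])
      finally show ?thesis using True compl by (simp add: unit_tensor_def S_def)
    next
      case False
      then show ?thesis
        by (auto simp: einstein_prod_def conj_transpose_def U_def S_def unit_tensor_def)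
    qed
    show "einstein_prod N I (conj_transpose U) U i k = unit_tensor N I i k"
    proof (cases "i \<in> S \<and> k \<in> S")
      case True
      then have "einstein_prod N I (conj_transpose U) U i k = qinner S (y (?lin i)) (y (?lin k))"
        by (simp add: einstein_prod_def conj_transpose_def U_def S_def qinner_def)
      also have "\<dots> = (if ?lin i = ?lin k then 1 else 0)"
        using on lin_in True by (auto simp: orthonormal_on_def)
      also have "?lin i = ?lin k \<longleftrightarrow> i = k" using pos_lin True by metis
      finally show ?thesis using True by (simp add: unit_tensor_def S_def)
    next
      case False
      then show ?thesis
        by (auto simp: einstein_prod_def conj_transpose_def U_def S_def unit_tensor_def)
    qed
  qed
  have UB: "einstein_prod N I U (of_real_tensor B) i k
      = (if k \<in> S \<and> ?lin k \<le> s then d (?lin k) *\<^sub>R U i k else 0)" for i k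
  proof -
    have "einstein_prod N I U (of_real_tensor B) i k
        = (\<Sum>j\<in>S. if j = k then (if ?lin k \<le> s then d (?lin k) *\<^sub>R U i k else 0) else 0)"
      unfolding einstein_prod_def S_def[symmetric]
      by (intro sum.cong) (auto simp: of_real_tensor_def B_def of_real_def)
    then show ?thesis using finS by simp
  qed
  have A: "A = einstein_prod N I (einstein_prod N I U (of_real_tensor B)) (eta_adjoint \<eta> U)"
  proof (intro ext)
    fix i j
    show "A i j = einstein_prod N I (einstein_prod N I U (of_real_tensor B)) (eta_adjoint \<eta> U) i j"
    proof (cases "i \<in> S \<and> j \<in> S")
      case True
      \<comment> \<open>These are the terms of the spectral expansion of A \<eta>. The right factor
        contributes -\<eta> times a conjugate times \<eta>, so the product sums to -(A \<eta>)
        \<eta>, which is A.\<close>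
      define t where "t m = y m i * (d m *\<^sub>R \<eta>) * quat_cnj (y m j)" for m
      have "einstein_prod N I (einstein_prod N I U (of_real_tensor B)) (eta_adjoint \<eta> U) i j
          = (\<Sum>k\<in>S. - ((if ?lin k \<le> s then t (?lin k) else 0) * \<eta>))"
        unfolding einstein_prod_def[of N I "einstein_prod N I U (of_real_tensor B)"] UB S_def[symmetric]
        using True by (intro sum.cong) (auto simp: eta_adjoint_def conj_transpose_def U_def t_def mult.assoc)
      also have "\<dots> = (\<Sum>m=1..n. - ((if m \<le> s then t m else 0) * \<eta>))"
        by (rule sum.reindex_bij_betw[OF lin])
      also have "\<dots> = (\<Sum>m=1..s. - ((if m \<le> s then t m else 0) * \<eta>))"
        using s by (intro sum.mono_neutral_right) auto
      also have "\<dots> = - ((\<Sum>m=1..s. t m) * \<eta>)"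
        by (simp add: sum_negf sum_distrib_right)
      also have "\<dots> = - (A i j * \<eta> * \<eta>)" using D True by (simp add: t_def)
      also have "\<dots> = A i j" by (simp add: mult.assoc eta)
      finally show ?thesis by simp
    next
      case False
      then have "A i j = 0" using assms(4) by (auto simp: tensors_def S_def)
      moreover have "U i k = 0 \<or> eta_adjoint \<eta> U k j = 0" for k
        using False by (auto simp: U_def eta_adjoint_def conj_transpose_def)
      then have "einstein_prod N I (einstein_prod N I U (of_real_tensor B)) (eta_adjoint \<eta> U) i j = 0"
        unfolding einstein_prod_def[of N I "einstein_prod N I U (of_real_tensor B)"] UB
        by (intro sum.neutral) fastforce
      ultimately show ?thesis by simp
    qed
  qed
  \<comment> \<open>The conjugate transpose of V is the right factor, so flattening the
    factorization yields a singular value decomposition.\<close>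
  define V where "V = conj_transpose (eta_adjoint \<eta> U)"
  have "conj_transpose V = eta_adjoint \<eta> U" by (simp add: V_def conj_transpose_def)
  moreover have "flatten N I I (of_real_tensor B) = diag_block_mat n n s d"
  proof (rule eq_matI)
    fix a b assume "a < dim_row (diag_block_mat n n s d)" "b < dim_col (diag_block_mat n n s d)"
    then have ab: "a < n" "b < n" by (auto simp: diag_block_mat_def)
    have pos_a: "?pos (a + 1) \<in> S" "?lin (?pos (a + 1)) = a + 1" and pos_b: "?lin (?pos (b + 1)) = b + 1"
      using ab by (auto intro!: pos_in)
    have "?pos (a + 1) = ?pos (b + 1) \<longleftrightarrow> a = b"
      using pos_a(2) pos_b by (metis add_right_cancel)
    then have "B (?pos (a + 1)) (?pos (b + 1)) = (if a = b \<and> a < s then d (a + 1) else 0)"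
      using pos_a pos_b by (simp add: B_def Suc_le_eq)
    then show "flatten N I I (of_real_tensor B) $$ (a, b) = diag_block_mat n n s d $$ (a, b)"
      using ab flatten_index[OF assms(1), of a I b I "of_real_tensor B"]
      by (simp add: of_real_tensor_def diag_block_mat_def n_def)
  qed (auto simp: diag_block_mat_def n_def)
  ultimately have svd: "flatten N I I A
      = flatten N I I U * diag_block_mat n n s d * quat_adjoint (flatten N I I V)"
    by (subst A) (simp only: flatten_einstein_prod[OF assms(1)]
        flip: flatten_conj_transpose[OF assms(1)])
  have UV: "unitary_quat_mat n (flatten N I I U)" "unitary_quat_mat n (flatten N I I V)"
    unfolding V_def n_def
    using unitary_flatten[OF assms(1)] unitary_conj_transpose_eta_adjoint[OF assms(3)] U by blast+
  \<comment> \<open>The number \<open>s\<close> counts the positive eigenvalues; only the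
    decomposition just obtained identifies it with the rank.\<close>
  have rs: "r = s"
    unfolding assms(6)
  proof (rule quat_rank_svd[OF UV s s _ svd])
    show "d m \<noteq> 0" if "m \<in> {1..s}" for m using pos[OF that] by simp
  qed
  have "nonzero_singular_values (flatten N I I A) r d"
    unfolding nonzero_singular_values_def flatten_dims n_def[symmetric]
  proof (intro conjI exI)
    show "r = quat_rank (flatten N I I A)" by (rule assms(6))
    show "\<forall>i\<in>{1..r}. 0 < d i" using pos by (simp add: rs)
    show "flatten N I I A
        = flatten N I I U * diag_block_mat n n r d * quat_adjoint (flatten N I I V)"
      unfolding rs by (rule svd)
  qed (rule UV)+
  moreover have "B \<in> tensors N I N I" by (auto simp: tensors_def B_def S_def)
  moreover have "B (?pos m) (?pos m) = d m" if "m \<in> {1..r}" for m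
    using that s pos_in[of m] by (simp add: B_def rs)
  moreover have "B i j = 0"
    if "i \<in> S" "j \<in> S" "\<not> (\<exists>m\<in>{1..r}. i = ?pos m \<and> j = ?pos m)" for i j
    using that lin_in[of i] pos_lin[of i] by (force simp: B_def rs)
  ultimately show ?thesis
    using U A unfolding S_def[symmetric] by (intro exI[of _ U] exI[of _ B] exI[of _ d] conjI) blast+
qed

end
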